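(* Let $(Y,\lambda_0,\Lambda_1)$ be a solution of the controlled martingale problem for $(A,E_0,B,\Xi)$ with right continuous filtration $\{\mathcal F_t\}$. Let $\tau(t)=\inf\{s:\lambda_0(s)>t\}$, $t\ge0$, and $\mathcal G_t=\mathcal F_{\tau(t)}$. Define $X(t)=Y(\tau(t))$ and $$\Lambda([0,t]\times C)=\int_{[0,\tau(t)]\times U}\mathbf 1_C(Y(s),u)\Lambda_1(ds\times du),\qquad C\in\mathcal B(\Xi).$$ Suppose there exists a sequence $\eta_n$ of $\{\mathcal G_t\}$-stopping times such that $\eta_n\to\infty$ and, for each $n$, $E[\tau(\eta_n)]<\infty$. Then $X\in D_{\overline E_0}[0,\infty)$ and, for each $f\in\mathcal D$, $$f(X(t))-f(X(0))-\int_0^tAf(X(s))ds-\int_{[0,t]\times\Xi}Bf(x,u)\Lambda(ds\times dx\times du)$$ is a $\{\mathcal G_t\}$-local martingale.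
   Context: Setting. $E$ is a compact metric space, $E_0\subset E$ is open, $A\subset C(E)\times C(E)$ is an operator (identified with its graph, $f\mapsto Af$) with $(1,0)\in A$. $U$ is a compact metric space, $\Xi$ is a closed subset of $E_0^c\times U$, and $B\subset C(E)\times C(\Xi)$ is an operator with $(1,0)\in B$. $\mathcal D=\mathcal D(A)\cap\mathcal D(B)$. For Borel $F\subset E$, $\mathcal P(F)$ is the set of Borel probability measures $\nu$ on $E$ with $\nu(F)=1$. $\mathcal L_U$ is the space of measures $\mu$ on $[0,\infty)\times U$ with $\mu([0,t]\times U)<\infty$ for all $t$, with convergence $\mu_n\to\mu$ iff $\int f\,d\mu_n\to\int f\,d\mu$ for all continuous compactly supported $f$. An $\mathcal L_U$-valued random variable $\Lambda_1$ is adapted to $\{\mathcal F_t\}$ if $\Lambda_1([0,t]\times C)$ is $\mathcal F_t$-measurable for all $t$ and Borel $C\subset U$. Controlled martingale problem. $(Y,\lambda_0,\Lambda_1)$ is a solution of the controlled martingale problem for $(A,E_0,B,\Xi)$ with filtration $\{\mathcal F_t\}$ if $Y$ is a process with paths in the Skorohod space $D_E[0,\infty)$; $\lambda_0$ is nonnegative, nondecreasing and increases only when $Y\in\overline E_0$; $\Lambda_1$ is a random measure in $\mathcal L_U$ with $\lambda_1(t):=\Lambda_1([0,t]\times U)=\int_{[0,t]\times U}\mathbf 1_{\Xi}(Y(s),u)\Lambda_1(ds\times du)$; $\lambda_0(t)+\lambda_1(t)=t$; $Y,\lambda_0,\Lambda_1$ are $\{\mathcal F_t\}$-adapted and, for all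 $f\in\mathcal D$, $f(Y(t))-f(Y(0))-\int_0^tAf(Y(s))d\lambda_0(s)-\int_{[0,t]\times U}Bf(Y(s),u)\Lambda_1(ds\times du)$ is an $\{\mathcal F_t\}$-martingale. $\Pi_\nu$ denotes the set of distributions of solutions for which $Y(0)$ has distribution $\nu$. Standing assumptions: (a) $\mathcal D$ is dense in $C(E)$; (b) $\Pi_\nu\ne\emptyset$ for each $\nu\in\mathcal P(\overline E_0)$; (c) for each solution of the controlled martingale problem, $\lim_{t\to\infty}\lambda_0(t)=\infty$ a.s. *)

theory Defs
  imports "HOL-Probability.Probability"
begin

text \<open>Operators are identified with their graphs; \<^term>\<open>op_val R f\<close> is the value \<open>R f\<close>
  of a single-valued \<open>R\<close> at \<open>f\<close> in its domain.\<close>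

definition op_val :: "('f \<times> 'g) set \<Rightarrow> 'f \<Rightarrow> 'g" where
  "op_val R f = (THE g. (f, g) \<in> R)"

text \<open>\<open>C(S)\<close> for a subset \<open>S\<close> of the type; extensionality gives each continuous function on \<open>S\<close>
  exactly one representative.\<close>

definition cont_funs :: "'z::topological_space set \<Rightarrow> ('z \<Rightarrow> real) set" where
  "cont_funs S = {g \<in> extensional S. continuous_on S g}"

definition prob_measures_on :: "'e::topological_space set \<Rightarrow> 'e measure set" where
  "prob_measures_on S = {\<nu>. prob_space \<nu> \<and> sets \<nu> = sets borel \<and> emeasure \<nu> S = 1}"

text \<open>The path space \<open>D\<^sub>S[0,\<infinity>)\<close>. Paths are functions on the reals of which only the values at
  nonnegative times matter.\<close>

definition skorohod_paths :: "'e::topological_space set \<Rightarrow> (real \<Rightarrow> 'e) set" where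
  "skorohod_paths S = {y.
     (\<forall>t\<ge>0. y t \<in> S \<and> (y \<longlongrightarrow> y t) (at_right t)) \<and>
     (\<forall>t>0. \<exists>l\<in>S. (y \<longlongrightarrow> l) (at_left t))}"

text \<open>The measure \<open>dl\<close> on \<open>[0,\<infinity>)\<close> of a continuous nondecreasing \<open>l\<close> given for nonnegative times,
  as a measure on the reals without mass on \<open>(-\<infinity>,0]\<close>.\<close>

definition stieltjes :: "(real \<Rightarrow> real) \<Rightarrow> real measure" where
  "stieltjes l = interval_measure (\<lambda>s. l (max 0 s))"

text \<open>The space \<open>\<L>\<^sub>U\<close> for the whole type \<open>U\<close>, and the \<open>\<sigma>\<close>-algebra on it generated by the
  evaluations \<open>\<mu> \<mapsto> \<mu>([0,t] \<times> C)\<close>. For compact metric \<open>U\<close> this is the Borel \<open>\<sigma>\<close>-algebra of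
  convergence against continuous compactly supported functions.\<close>

definition L_space :: "(real \<times> 'u::topological_space) measure set" where
  "L_space = {\<mu>. sets \<mu> = sets (restrict_space borel ({0..} \<times> UNIV)) \<and>
                  (\<forall>t\<ge>0. emeasure \<mu> ({0..t} \<times> UNIV) < \<infinity>)}"

definition L_algebra :: "(real \<times> 'u::topological_space) measure measure" where
  "L_algebra = sigma L_space
     {{\<mu> \<in> L_space. emeasure \<mu> ({0..t} \<times> C) \<in> S} | t C S.
        0 \<le> t \<and> C \<in> sets borel \<and> S \<in> sets borel}"

text \<open>Filtrations are indexed by \<open>[0,\<infinity>]\<close>, so that stopping times may take the value \<open>\<infinity>\<close>:
  \<open>F \<infinity>\<close> is an arbitrary \<open>\<sigma>\<close>-algebra containing all \<open>F t\<close>, and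
  \<^const>\<open>filtration.pre_sigma\<close> consists of the events \<open>H \<in> F \<infinity>\<close> with
  \<open>H \<inter> {T \<le> t} \<in> F t\<close> for all finite \<open>t\<close>.\<close>

definition right_continuous_filtration :: "(ennreal \<Rightarrow> 'w measure) \<Rightarrow> bool" where
  "right_continuous_filtration F \<longleftrightarrow> (\<forall>t<\<infinity>. sets (F t) = (\<Inter>s\<in>{t<..}. sets (F s)))"

definition martingale ::
  "'w measure \<Rightarrow> (ennreal \<Rightarrow> 'w measure) \<Rightarrow> (real \<Rightarrow> 'w \<Rightarrow> real) \<Rightarrow> bool" where
  "martingale M F Z \<longleftrightarrow>
     (\<forall>t\<ge>0. Z t \<in> borel_measurable (F (ennreal t)) \<and> integrable M (Z t)) \<and>
     (\<forall>s t. 0 \<le> s \<and> s \<le> t \<longrightarrow>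
        (AE \<omega> in M. real_cond_exp M (F (ennreal s)) (Z t) \<omega> = Z s \<omega>))"

definition stopped :: "(real \<Rightarrow> 'w \<Rightarrow> 'b) \<Rightarrow> ('w \<Rightarrow> ennreal) \<Rightarrow> real \<Rightarrow> 'w \<Rightarrow> 'b" where
  "stopped Z T t \<omega> = Z (enn2real (min (ennreal t) (T \<omega>))) \<omega>"

definition local_martingale ::
  "'w measure \<Rightarrow> (ennreal \<Rightarrow> 'w measure) \<Rightarrow> (real \<Rightarrow> 'w \<Rightarrow> real) \<Rightarrow> bool" where
  "local_martingale M F Z \<longleftrightarrow>
     (\<forall>t\<ge>0. Z t \<in> borel_measurable (F (ennreal t))) \<and>
     (\<exists>\<sigma> :: nat \<Rightarrow> 'w \<Rightarrow> ennreal.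
        (\<forall>n. stopping_time F (\<sigma> n)) \<and>
        (AE \<omega> in M. incseq (\<lambda>n. \<sigma> n \<omega>) \<and> (\<lambda>n. \<sigma> n \<omega>) \<longlonglongrightarrow> \<infinity>) \<and>
        (\<forall>n. martingale M F (stopped Z (\<sigma> n))))"

text \<open>Since the random measure \<open>L1 \<omega>\<close> is carried by \<open>{(s,u). (Y s \<omega>, u) \<in> \<Xi>}\<close>, the values of
  \<open>B f\<close> off \<open>\<Xi>\<close> do not contribute to the last integral.\<close>

locale controlled_martingale_solution =
  prob_space M + filtration "space M" F
  for M :: "'w measure" and F :: "ennreal \<Rightarrow> 'w measure" +
  fixes A :: "(('e::metric_space \<Rightarrow>\<^sub>C real) \<times> ('e \<Rightarrow>\<^sub>C real)) set"
    and E0 :: "'e set"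
    and B :: "(('e \<Rightarrow>\<^sub>C real) \<times> ('e \<times> 'u::metric_space \<Rightarrow> real)) set"
    and \<Xi> :: "('e \<times> 'u) set"
    and Y :: "real \<Rightarrow> 'w \<Rightarrow> 'e"
    and l0 :: "real \<Rightarrow> 'w \<Rightarrow> real"
    and L1 :: "'w \<Rightarrow> (real \<times> 'u) measure"
  assumes subalg: "\<And>t. subalgebra M (F t)"
    and Y_paths: "\<And>\<omega>. \<omega> \<in> space M \<Longrightarrow> (\<lambda>t. Y t \<omega>) \<in> skorohod_paths UNIV"
    and l0_nonneg: "\<And>\<omega> t. \<omega> \<in> space M \<Longrightarrow> 0 \<le> t \<Longrightarrow> 0 \<le> l0 t \<omega>"
    and l0_mono: "\<And>\<omega>. \<omega> \<in> space M \<Longrightarrow> mono_on {0..} (\<lambda>t. l0 t \<omega>)"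
    and l0_increase: "\<And>\<omega>. \<omega> \<in> space M \<Longrightarrow>
          AE s in stieltjes (\<lambda>s. l0 s \<omega>). 0 \<le> s \<longrightarrow> Y s \<omega> \<in> closure E0"
    and L1_space: "\<And>\<omega>. \<omega> \<in> space M \<Longrightarrow> L1 \<omega> \<in> L_space"
    and L1_carrier: "\<And>\<omega> t. \<omega> \<in> space M \<Longrightarrow> 0 \<le> t \<Longrightarrow>
          emeasure (L1 \<omega>) ({0..t} \<times> UNIV) =
            (\<integral>\<^sup>+z\<in>{0..t} \<times> UNIV. indicator \<Xi> (Y (fst z) \<omega>, snd z) \<partial>L1 \<omega>)"
    and clock: "\<And>\<omega> t. \<omega> \<in> space M \<Longrightarrow> 0 \<le> t \<Longrightarrow>
          l0 t \<omega> + measure (L1 \<omega>) ({0..t} \<times> UNIV) = t"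
    and Y_adapted: "\<And>t. 0 \<le> t \<Longrightarrow> Y t \<in> F (ennreal t) \<rightarrow>\<^sub>M borel"
    and l0_adapted: "\<And>t. 0 \<le> t \<Longrightarrow> l0 t \<in> borel_measurable (F (ennreal t))"
    and L1_adapted: "\<And>t C. 0 \<le> t \<Longrightarrow> C \<in> sets borel \<Longrightarrow>
          (\<lambda>\<omega>. emeasure (L1 \<omega>) ({0..t} \<times> C)) \<in> borel_measurable (F (ennreal t))"
    and martingale_property: "\<And>f. f \<in> Domain A \<inter> Domain B \<Longrightarrow>
          martingale M F (\<lambda>t \<omega>.
            apply_bcontfun f (Y t \<omega>) - apply_bcontfun f (Y 0 \<omega>)
            - (LINT s:{0..t}|stieltjes (\<lambda>s. l0 s \<omega>). apply_bcontfun (op_val A f) (Y s \<omega>))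
            - (LINT z:{0..t} \<times> UNIV|L1 \<omega>. op_val B f (Y (fst z) \<omega>, snd z)))"

text \<open>Distributions of triples \<open>(Y, l0, L1)\<close>. The cylinder \<open>\<sigma>\<close>-algebra used for the first
  component induces on \<open>D\<^sub>E[0,\<infinity>)\<close> the Borel \<open>\<sigma>\<close>-algebra of the Skorohod topology.\<close>

type_synonym ('e, 'u) trajectory = "(real \<Rightarrow> 'e) \<times> (real \<Rightarrow> real) \<times> (real \<times> 'u) measure"

definition trajectory_algebra ::
  "('e::topological_space, 'u::topological_space) trajectory measure" where
  "trajectory_algebra =
     PiM {0..} (\<lambda>_. borel) \<Otimes>\<^sub>M (PiM {0..} (\<lambda>_. borel) \<Otimes>\<^sub>M L_algebra)"

definition trajectory_law ::
  "'w measure \<Rightarrow> (real \<Rightarrow> 'w \<Rightarrow> 'e::topological_space) \<Rightarrow> (real \<Rightarrow> 'w \<Rightarrow> real)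
   \<Rightarrow> ('w \<Rightarrow> (real \<times> 'u::topological_space) measure) \<Rightarrow> ('e, 'u) trajectory measure" where
  "trajectory_law M Y l0 L1 =
     distr M trajectory_algebra
       (\<lambda>\<omega>. (restrict (\<lambda>t. Y t \<omega>) {0..}, restrict (\<lambda>t. l0 t \<omega>) {0..}, L1 \<omega>))"

text \<open>The set \<open>\<Pi>\<^sub>\<nu>\<close>. HOL cannot quantify over the type of the sample space, so the solutions are
  taken on sample spaces of trajectories. Every distribution of a solution is obtained this way:
  a solution is also one for its natural filtration, and can then be transported to the
  coordinate process on the set of its trajectories.\<close>

definition solution_laws ::
  "(('e::metric_space \<Rightarrow>\<^sub>C real) \<times> ('e \<Rightarrow>\<^sub>C real)) set \<Rightarrow> 'e set
   \<Rightarrow> (('e \<Rightarrow>\<^sub>C real) \<times> ('e \<times> 'u::metric_space \<Rightarrow> real)) set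
   \<Rightarrow> ('e \<times> 'u) set \<Rightarrow> 'e measure \<Rightarrow> ('e, 'u) trajectory measure set" where
  "solution_laws A E0 B \<Xi> \<nu> =
     {trajectory_law M Y l0 L1 | (M :: ('e, 'u) trajectory measure) F Y l0 L1.
        controlled_martingale_solution M F A E0 B \<Xi> Y l0 L1 \<and> distr M borel (Y 0) = \<nu>}"

text \<open>\<open>\<tau>(t) = inf {s. l0 s > t}\<close>, with value \<open>\<infinity>\<close> if there is no such \<open>s\<close>; in particular
  \<open>\<tau>(\<infinity>) = \<infinity>\<close>.\<close>

definition inverse_clock :: "(real \<Rightarrow> 'w \<Rightarrow> real) \<Rightarrow> ennreal \<Rightarrow> 'w \<Rightarrow> ennreal" where
  "inverse_clock l0 t \<omega> = (INF s\<in>{s. 0 \<le> s \<and> t < ennreal (l0 s \<omega>)}. ennreal s)"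

text \<open>\<open>X(t) = Y(\<tau>(t))\<close>. Where \<open>\<tau>(t) = \<infinity>\<close>, which has probability zero once \<open>l0 \<rightarrow> \<infinity>\<close> almost
  surely, this formula gives the value \<open>Y(0)\<close>.\<close>

definition time_changed ::
  "(real \<Rightarrow> 'w \<Rightarrow> 'e) \<Rightarrow> (real \<Rightarrow> 'w \<Rightarrow> real) \<Rightarrow> real \<Rightarrow> 'w \<Rightarrow> 'e" where
  "time_changed Y l0 t \<omega> = Y (enn2real (inverse_clock l0 (ennreal t) \<omega>)) \<omega>"

end

theory Submission
  imports Defs
begin

text \<open>
  For \<open>f \<in> \<D>\<close> let \<open>N\<close> be the martingale of the controlled martingale problem. The clock \<open>l0\<close> is
  1-Lipschitz and \<open>\<tau>(t) < s\<close> iff \<open>t < l0(s)\<close>, so \<open>\<tau>(S)\<close> is an \<open>F\<close>-stopping time for every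
  \<open>G\<close>-stopping time \<open>S\<close>. Since \<open>dl0\<close> on \<open>[0,\<tau>(t)]\<close> is the image of Lebesgue measure on \<open>[0,t]\<close>
  under \<open>\<tau>\<close>, the time-changed process is almost surely \<open>N(\<tau>(t)) + f(Y(0)) - f(X(0))\<close>. As \<open>N(t)\<close> is
  bounded by an affine function of \<open>t\<close>, optional stopping holds at every \<open>\<tau>(S)\<close> of finite mean, and
  \<open>max(\<eta>\<^sub>0,\<dots>,\<eta>\<^sub>n)\<close> is a localizing sequence. The filtration is not assumed complete, so adaptedness
  of each term has to be checked also on the null set where \<open>\<tau>\<close> becomes infinite. The path
  \<open>Y\<close> visits \<open>closure E0\<close> immediately after each time \<open>\<tau>(t)\<close> because \<open>l0\<close> increases there, which
  puts \<open>X(t)\<close> into \<open>closure E0\<close>.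
\<close>

section \<open>Right-continuous processes and stopping times\<close>

text \<open>Two obstacles shape the proof. First, almost sure identities serve for expectations
  only: no sigma-algebra here is assumed complete, so measurability, adaptedness and right
  continuity are derived at every sample point, with explicit values where \<open>\<tau>\<close> is
  infinite. Second, \<open>op_val B f\<close> is meaningful only on \<open>\<Xi>\<close>, whereas
  measurability of its integral comes from sampling \<open>Y\<close> at neighbouring times, which
  may leave \<open>\<Xi>\<close>; it is therefore traded for a continuous extension \<open>g\<close>
  to the whole product. The martingale property is reduced to one number: the expectation has to be
  the same at all finite \<open>G\<close>-stopping times below the localizing one. The correction
  f(Y(0)) - f(X(0)) then counts only through its mean; it arises because the clock may stand still
  at first, which makes \<tau>(0) positive. The affine bound comes from the clock identity: up to
  time t both dl0 and \<open>L1\<close> have mass at most t.\<close>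

definition grid_above :: "nat \<Rightarrow> real \<Rightarrow> real" where
  "grid_above n r = (real_of_int \<lfloor>real (Suc n) * r\<rfloor> + 1) / real (Suc n)"

lemma grid_above_gt: "r < grid_above n r"
proof -
  have "real (Suc n) * r < real_of_int \<lfloor>real (Suc n) * r\<rfloor> + 1" by linarith
  then show ?thesis unfolding grid_above_def by (simp add: field_simps)
qed

lemma grid_above_le: "grid_above n r \<le> r + 1 / real (Suc n)"
proof -
  have "real_of_int \<lfloor>real (Suc n) * r\<rfloor> \<le> real (Suc n) * r" by linarith
  then have "(real_of_int \<lfloor>real (Suc n) * r\<rfloor> + 1) / real (Suc n) \<le> (real (Suc n) * r + 1) / real (Suc n)"
    by (intro divide_right_mono) auto
  also have "\<dots> = r + 1 / real (Suc n)"
    by (simp only: add_divide_distrib nonzero_mult_div_cancel_left of_nat_eq_0_iff nat.distinct simp_thms)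
  finally show ?thesis unfolding grid_above_def .
qed

text \<open>Floor plus one, not the ceiling: the value lies strictly above \<open>r\<close> even
  when \<open>r\<close> is a grid point, so limits along \<open>at_right r\<close> apply. The cell
  sent to a grid point is [k/m, (k+1)/m), which is decided by its right endpoint.\<close>

lemma grid_above_at_right: "filterlim (\<lambda>n. grid_above n r) (at_right r) sequentially"
proof (rule filterlim_at_withinI)
  show "(\<lambda>n. grid_above n r) \<longlonglongrightarrow> r"
  proof (rule tendsto_sandwich[where f="\<lambda>_. r" and h="\<lambda>n. r + 1 / real (Suc n)"])
    show "(\<lambda>n. r + 1 / real (Suc n)) \<longlonglongrightarrow> r"
      using tendsto_add[OF tendsto_const[of r] LIMSEQ_inverse_real_of_nat]
      by (simp add: inverse_eq_divide)
  qed (intro always_eventually allI grid_above_le less_imp_le[OF grid_above_gt] tendsto_const)+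
qed (auto intro!: always_eventually simp: grid_above_gt less_imp_neq[OF grid_above_gt, symmetric])

text \<open>Cutting at \<open>t\<close> keeps all sampling times at or below \<open>t\<close>, so
  sampled values can be measurable at time \<open>t\<close>. In exchange the sampling time is
  constantly \<open>r\<close> when \<open>r = t\<close>, which is why right continuity is asked only
  for \<open>r < t\<close>.\<close>

lemma tendsto_min_grid_above:
  fixes w :: "real \<Rightarrow> 'b::topological_space"
  assumes "r \<le> t" and rc: "r < t \<Longrightarrow> (w \<longlongrightarrow> w r) (at_right r)"
  shows "(\<lambda>n. w (min t (grid_above n r))) \<longlonglongrightarrow> w r"
proof (cases "r = t")
  case True
  then have "min t (grid_above n r) = r" for n
    using grid_above_gt[of r n] by auto
  then show ?thesis by simp
next
  case False
  with assms(1) have "r < t" by simp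
  have "(\<lambda>n. w (grid_above n r)) \<longlonglongrightarrow> w r"
    by (rule filterlim_compose[OF rc grid_above_at_right]) fact
  moreover have "(\<lambda>n. grid_above n r) \<longlonglongrightarrow> r"
    using grid_above_at_right filterlim_at by blast
  then have "eventually (\<lambda>n. grid_above n r < t) sequentially"
    using \<open>r < t\<close> by (rule order_tendstoD)
  then have "eventually (\<lambda>n. w (grid_above n r) = w (min t (grid_above n r))) sequentially"
    by eventually_elim auto
  ultimately show ?thesis by (rule Lim_transform_eventually)
qed

text \<open>Sampling at grid points makes the random time countably valued, and right continuity
  recovers the composition as a limit. Only times up to \<open>t\<close> enter, so \<open>N\<close>
  may be a member \<open>F t\<close> of a filtration: this is progressive measurability.\<close>

lemma measurable_compose_right_continuous:
  fixes W :: "real \<Rightarrow> 'a \<Rightarrow> 'b::metric_space"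
  assumes R[measurable]: "R \<in> borel_measurable N"
    and R_range: "\<And>x. x \<in> space N \<Longrightarrow> 0 \<le> R x \<and> R x \<le> t"
    and W: "\<And>s. 0 \<le> s \<Longrightarrow> s \<le> t \<Longrightarrow> W s \<in> N \<rightarrow>\<^sub>M borel"
    and rc: "\<And>x s. x \<in> space N \<Longrightarrow> 0 \<le> s \<Longrightarrow> s < t \<Longrightarrow> ((\<lambda>s. W s x) \<longlongrightarrow> W s x) (at_right s)"
  shows "(\<lambda>x. W (R x) x) \<in> N \<rightarrow>\<^sub>M borel"
proof (cases "space N = {}")
  case True
  then show ?thesis by (simp add: measurable_def sets_eq_bot2)
next
  case False
  with R_range have t: "0 \<le> t" by (meson all_not_in_conv order_trans)
  show ?thesis
  proof (rule borel_measurable_LIMSEQ_metric)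
    fix n
    \<comment> \<open>The index \<open>k\<close> runs over all integers, including negative ones,
      where \<open>W\<close> is not known to be measurable; \<open>max 0\<close> excludes those
      times and changes nothing at the actual values of the floor.\<close>
    have "(\<lambda>x. W (max 0 (min t ((real_of_int \<lfloor>real (Suc n) * R x\<rfloor> + 1) / real (Suc n)))) x) \<in> N \<rightarrow>\<^sub>M borel"
      by (rule measurable_compose_countable[where
          f="\<lambda>k x. W (max 0 (min t ((real_of_int k + 1) / real (Suc n)))) x" and
          g="\<lambda>x. \<lfloor>real (Suc n) * R x\<rfloor>"]) (auto intro!: W simp: t)
    then show "(\<lambda>x. W (min t (grid_above n (R x))) x) \<in> N \<rightarrow>\<^sub>M borel"
    proof (rule measurable_cong[THEN iffD1, rotated])
      fix x assume "x \<in> space N"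
      then have "0 \<le> min t (grid_above n (R x))"
        using R_range[of x] grid_above_gt[of "R x" n] t by auto
      then show "W (max 0 (min t ((real_of_int \<lfloor>real (Suc n) * R x\<rfloor> + 1) / real (Suc n)))) x =
        W (min t (grid_above n (R x))) x" by (simp add: grid_above_def)
    qed
  next
    fix x assume x: "x \<in> space N"
    show "(\<lambda>n. W (min t (grid_above n (R x))) x) \<longlonglongrightarrow> W (R x) x"
      by (rule tendsto_min_grid_above[where w="\<lambda>s. W s x"]) (use R_range[OF x] rc[OF x] in auto)
  qed
qed

lemma measurable_compose_right_continuous_unbounded:
  fixes W :: "real \<Rightarrow> 'a \<Rightarrow> 'b::metric_space"
  assumes R[measurable]: "R \<in> borel_measurable N"
    and R_range: "\<And>x. x \<in> space N \<Longrightarrow> 0 \<le> R x"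
    and W: "\<And>s. 0 \<le> s \<Longrightarrow> W s \<in> N \<rightarrow>\<^sub>M borel"
    and rc: "\<And>x s. x \<in> space N \<Longrightarrow> 0 \<le> s \<Longrightarrow> ((\<lambda>s. W s x) \<longlongrightarrow> W s x) (at_right s)"
  shows "(\<lambda>x. W (R x) x) \<in> N \<rightarrow>\<^sub>M borel"
proof (rule borel_measurable_LIMSEQ_metric)
  fix n :: nat
  show "(\<lambda>x. W (min (real n) (R x)) x) \<in> N \<rightarrow>\<^sub>M borel"
    by (rule measurable_compose_right_continuous[where t="real n"]) (auto simp: R_range W rc)
next
  fix x assume "x \<in> space N"
  have "eventually (\<lambda>n. R x \<le> real n) sequentially"
    by (meson eventually_sequentiallyI of_nat_mono order_trans real_arch_simple)
  then have "eventually (\<lambda>n. W (min (real n) (R x)) x = W (R x) x) sequentially"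
    by eventually_elim (simp add: min_def)
  then show "(\<lambda>n. W (min (real n) (R x)) x) \<longlonglongrightarrow> W (R x) x"
    by (rule tendsto_eventually)
qed

section \<open>Stopping times of filtrations indexed by [0,\<infinity>]\<close>

lemma (in filtration) measurable_mono: "f \<in> F s \<rightarrow>\<^sub>M N \<Longrightarrow> s \<le> t \<Longrightarrow> f \<in> F t \<rightarrow>\<^sub>M N"
  using sets_F_mono[of s t] by (auto simp: measurable_def space_F)

locale ennreal_filtration = filtration \<Omega> F
  for \<Omega> :: "'w set" and F :: "ennreal \<Rightarrow> 'w measure"
begin

lemma stopping_time_min_measurable:
  assumes T: "stopping_time F T"
  shows "(\<lambda>\<omega>. min t (T \<omega>)) \<in> borel_measurable (F t)"
proof (rule borel_measurableI_le)
  fix s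
  have "{\<omega> \<in> space (F t). min t (T \<omega>) \<le> s} =
    (if t \<le> s then space (F t) else {\<omega> \<in> space (F t). T \<omega> \<le> s})"
    by (auto simp: min_le_iff_disj)
  also have "\<dots> \<in> sets (F t)"
    using stopping_time_le_const[OF T, of s t] by (auto simp: Measurable.pred_def)
  finally show "{\<omega> \<in> space (F t). min t (T \<omega>) \<le> s} \<in> sets (F t)" .
qed

lemma stopped_measurable:
  fixes W :: "real \<Rightarrow> 'w \<Rightarrow> 'b::metric_space"
  assumes T: "stopping_time F T" and t: "0 \<le> t"
    and W: "\<And>s. 0 \<le> s \<Longrightarrow> W s \<in> F (ennreal s) \<rightarrow>\<^sub>M borel"
    and rc: "\<And>\<omega> s. \<omega> \<in> \<Omega> \<Longrightarrow> 0 \<le> s \<Longrightarrow> ((\<lambda>s. W s \<omega>) \<longlongrightarrow> W s \<omega>) (at_right s)"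
  shows "stopped W T t \<in> F (ennreal t) \<rightarrow>\<^sub>M borel"
  unfolding stopped_def[abs_def]
proof (rule measurable_compose_right_continuous[where t=t])
  show "(\<lambda>\<omega>. enn2real (min (ennreal t) (T \<omega>))) \<in> borel_measurable (F (ennreal t))"
    using stopping_time_min_measurable[OF T] by measurable
  show "0 \<le> enn2real (min (ennreal t) (T \<omega>)) \<and> enn2real (min (ennreal t) (T \<omega>)) \<le> t" for \<omega>
    using t by (auto intro: enn2real_leI)
qed (auto simp: space_F rc intro: measurable_mono[OF W] ennreal_leI)

text \<open>\<open>pre_sigma\<close> tests an event at every index. On T \<le> t with
  \<open>t\<close> finite the variable coincides with the process stopped at \<open>t\<close>, which
  \<open>F t\<close> measures. At index infinity the event splits into the pieces T \<le> n, settled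
  by the finite case, and T = \<infinity>, where \<open>Winf\<close> supplies the value.\<close>

lemma pre_sigma_measurable_at_stopping_time:
  fixes W :: "real \<Rightarrow> 'w \<Rightarrow> 'b::metric_space"
  assumes T: "stopping_time F T"
    and W: "\<And>s. 0 \<le> s \<Longrightarrow> W s \<in> F (ennreal s) \<rightarrow>\<^sub>M borel"
    and Winf: "Winf \<in> F \<infinity> \<rightarrow>\<^sub>M borel"
    and rc: "\<And>\<omega> s. \<omega> \<in> \<Omega> \<Longrightarrow> 0 \<le> s \<Longrightarrow> ((\<lambda>s. W s \<omega>) \<longlongrightarrow> W s \<omega>) (at_right s)"
  shows "(\<lambda>\<omega>. if T \<omega> = \<infinity> then Winf \<omega> else W (enn2real (T \<omega>)) \<omega>) \<in> pre_sigma T \<rightarrow>\<^sub>M borel"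
    (is "?V \<in> _")
proof (rule measurableI)
  fix S :: "'b set" assume S: "S \<in> sets borel"
  have fin: "{\<omega> \<in> \<Omega>. ?V \<omega> \<in> S \<and> T \<omega> \<le> ennreal t} \<in> sets (F (ennreal t))" if t: "0 \<le> t" for t
  proof -
    have "{\<omega> \<in> \<Omega>. ?V \<omega> \<in> S \<and> T \<omega> \<le> ennreal t} =
      {\<omega> \<in> space (F (ennreal t)). T \<omega> \<le> ennreal t} \<inter> (stopped W T t -` S \<inter> space (F (ennreal t)))"
      by (auto simp: stopped_def space_F min_def top_unique split: if_splits)
    also have "\<dots> \<in> sets (F (ennreal t))"
      using stopping_timeD[OF T, of "ennreal t"] measurable_sets[OF stopped_measurable[OF T t W rc] S]
      by (auto simp: Measurable.pred_def)
    finally show ?thesis .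
  qed
  show "?V -` S \<inter> space (pre_sigma T) \<in> sets (pre_sigma T)"
  proof (rule sets_pre_sigmaI[OF T])
    fix t
    have eq: "{\<omega> \<in> ?V -` S \<inter> space (pre_sigma T). T \<omega> \<le> t} = {\<omega> \<in> \<Omega>. ?V \<omega> \<in> S \<and> T \<omega> \<le> t}"
      by (auto simp: space_pre_sigma)
    show "{\<omega> \<in> ?V -` S \<inter> space (pre_sigma T). T \<omega> \<le> t} \<in> sets (F t)"
    proof (cases t)
      case (real r)
      then show ?thesis unfolding eq using fin[of r] by simp
    next
      case top
      have "{\<omega> \<in> \<Omega>. ?V \<omega> \<in> S \<and> T \<omega> \<le> t} =
        (\<Union>n. {\<omega> \<in> \<Omega>. ?V \<omega> \<in> S \<and> T \<omega> \<le> ennreal (real n)}) \<union>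
        ((space (F \<infinity>) - (\<Union>n. {\<omega> \<in> space (F \<infinity>). T \<omega> \<le> ennreal (real n)})) \<inter> (Winf -` S \<inter> space (F \<infinity>)))"
        (is "?L = ?A \<union> ?B")
      proof -
        have *: "T \<omega> = top \<longleftrightarrow> (\<forall>n. \<not> T \<omega> \<le> ennreal (real n))" for \<omega>
        proof (cases "T \<omega>")
          case (real r)
          obtain n where "r \<le> real n" using real_arch_simple by blast
          then show ?thesis using real by (auto intro!: exI[of _ n] ennreal_leI)
        qed (auto simp: top_unique)
        show ?thesis unfolding top infinity_ennreal_def using *
          by (auto simp: space_F split: if_splits)
      qed
      also have "\<dots> \<in> sets (F \<infinity>)"
      proof (intro sets.Un sets.Int[OF sets.Diff[OF sets.top] measurable_sets[OF Winf S]] sets.countable_UN)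
        show "range (\<lambda>n. {\<omega> \<in> \<Omega>. ?V \<omega> \<in> S \<and> T \<omega> \<le> ennreal (real n)}) \<subseteq> sets (F \<infinity>)"
          using sets_F_mono[of _ \<infinity>] by (intro image_subsetI subsetD[OF _ fin]) auto
        show "range (\<lambda>n. {\<omega> \<in> space (F \<infinity>). T \<omega> \<le> ennreal (real n)}) \<subseteq> sets (F \<infinity>)"
          using stopping_time_le_const[OF T, of _ \<infinity>] by (auto simp: Measurable.pred_def space_F)
      qed
      finally show ?thesis unfolding eq by (simp add: top)
    qed
  qed
qed auto

text \<open>For each u > r the event T \<le> r is an intersection of events T < e n with r < e n
  \<le> u, hence lies in \<open>F u\<close>; right continuity of the filtration passes to
  \<open>F r\<close>. The clock yields strict inequalities \<tau> < s, so the criterion is stated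
  with these.\<close>

lemma stopping_time_right_continuousI:
  assumes rcF: "right_continuous_filtration F"
    and less: "\<And>s. 0 < s \<Longrightarrow> {\<omega> \<in> \<Omega>. T \<omega> < ennreal s} \<in> sets (F (ennreal s))"
  shows "stopping_time F T"
proof (rule stopping_timeI)
  fix t
  show "Measurable.pred (F t) (\<lambda>\<omega>. T \<omega> \<le> t)"
  proof (cases t)
    case top
    then show ?thesis by simp
  next
    case (real r)
    have "{\<omega> \<in> \<Omega>. T \<omega> \<le> ennreal r} \<in> sets (F u)" if u: "ennreal r < u" for u
    proof -
      \<comment> \<open>\<open>u\<close> may be infinite while \<open>less\<close> speaks of real
        times, so a real \<open>v\<close> is put in between and all \<open>e n\<close> are kept at
        or below it.\<close>
      obtain v where v: "ennreal r < ennreal v" "ennreal v < u" "0 \<le> v"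
        using dense[OF u] by (metis ennreal_cases less_top order_less_trans infinity_ennreal_def not_less_iff_gr_or_eq)
      have rv: "r < v" using v(1) real(1) by (simp add: ennreal_less_iff)
      define e where "e n = r + (v - r) / real (Suc n)" for n
      have e: "r < e n" "e n \<le> v" for n
      proof -
        show "r < e n" using rv by (simp add: e_def)
        have "(v - r) / real (Suc n) \<le> (v - r) / 1" using rv by (intro divide_left_mono) auto
        then show "e n \<le> v" by (simp add: e_def)
      qed
      have elim: "e \<longlonglongrightarrow> r"
      proof -
        have "(\<lambda>n. r + (v - r) * inverse (real (Suc n))) \<longlonglongrightarrow> r + (v - r) * 0"
          by (intro tendsto_intros LIMSEQ_inverse_real_of_nat)
        then show ?thesis by (simp add: e_def[abs_def] divide_inverse)
      qed
      have "{\<omega> \<in> \<Omega>. T \<omega> \<le> ennreal r} = (\<Inter>n. {\<omega> \<in> \<Omega>. T \<omega> < ennreal (e n)})"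
      proof (intro set_eqI iffI)
        fix \<omega> assume "\<omega> \<in> {\<omega> \<in> \<Omega>. T \<omega> \<le> ennreal r}"
        then show "\<omega> \<in> (\<Inter>n. {\<omega> \<in> \<Omega>. T \<omega> < ennreal (e n)})"
          using e(1) real(1) by (auto intro: le_less_trans simp: ennreal_less_iff)
      next
        fix \<omega> assume *: "\<omega> \<in> (\<Inter>n. {\<omega> \<in> \<Omega>. T \<omega> < ennreal (e n)})"
        have "T \<omega> \<le> ennreal r"
          by (rule LIMSEQ_le_const[OF tendsto_ennrealI[OF elim]]) (use * in \<open>auto intro: less_imp_le\<close>)
        with * show "\<omega> \<in> {\<omega> \<in> \<Omega>. T \<omega> \<le> ennreal r}" by auto
      qed
      also have "\<dots> \<in> sets (F u)"
      proof (intro sets.countable_INT image_subsetI)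
        fix n
        have "0 < e n" using e(1)[of n] real(1) by simp
        moreover have "ennreal (e n) \<le> u" using e(2)[of n] v(2) by (meson ennreal_leI less_imp_le order_trans)
        ultimately show "{\<omega> \<in> \<Omega>. T \<omega> < ennreal (e n)} \<in> sets (F u)"
          using less[of "e n"] sets_F_mono[of "ennreal (e n)" u] by auto
      qed auto
      finally show ?thesis .
    qed
    then have "{\<omega> \<in> \<Omega>. T \<omega> \<le> ennreal r} \<in> sets (F (ennreal r))"
      using rcF unfolding right_continuous_filtration_def by auto
    then show ?thesis unfolding real by (simp add: Measurable.pred_def space_F)
  qed
qed

end

section \<open>Optional stopping\<close>

text \<open>Instantiated twice: optional stopping is applied in \<open>F\<close>, the criterion for
  stopped martingales in the time-changed filtration \<open>G\<close>.\<close>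

locale filtered_prob_space = prob_space M + ennreal_filtration "space M" F
  for M :: "'w measure" and F :: "ennreal \<Rightarrow> 'w measure" +
  assumes subalgebra_F: "\<And>t. subalgebra M (F t)"
begin

lemma sets_F_subset: "A \<in> sets (F t) \<Longrightarrow> A \<in> sets M"
  using subalgebra_F[of t] by (auto simp: subalgebra_def)

lemma measurable_F: "f \<in> F t \<rightarrow>\<^sub>M N \<Longrightarrow> f \<in> M \<rightarrow>\<^sub>M N"
  by (rule measurable_from_subalg[OF subalgebra_F])

lemma finite_measure_subalgebra_F: "finite_measure_subalgebra M (F t)"
  by unfold_locales (rule subalgebra_F)

lemma stopping_time_measurable: "stopping_time F T \<Longrightarrow> T \<in> borel_measurable M"
  by (rule measurable_stopping_time[where F=F]) (auto simp: space_F sets_F_subset)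

lemma martingale_set_integral:
  assumes Z: "martingale M F Z" and st: "0 \<le> s" "s \<le> t" and A: "A \<in> sets (F (ennreal s))"
  shows "(LINT \<omega>:A|M. Z s \<omega>) = (LINT \<omega>:A|M. Z t \<omega>)"
proof -
  interpret S: finite_measure_subalgebra M "F (ennreal s)" by (rule finite_measure_subalgebra_F)
  have "integrable M (Z t)" using Z st by (auto simp: martingale_def)
  then have "(LINT \<omega>:A|M. Z t \<omega>) = (LINT \<omega>:A|M. real_cond_exp M (F (ennreal s)) (Z t) \<omega>)"
    by (rule S.real_cond_exp_intA) (rule A)
  also have "\<dots> = (LINT \<omega>:A|M. Z s \<omega>)"
  proof (rule set_lebesgue_integral_cong_AE)
    show "AE \<omega>\<in>A in M. real_cond_exp M (F (ennreal s)) (Z t) \<omega> = Z s \<omega>"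
    proof -
      have "AE \<omega> in M. real_cond_exp M (F (ennreal s)) (Z t) \<omega> = Z s \<omega>"
        using Z st by (simp add: martingale_def)
      then show ?thesis by (rule AE_mp) simp
    qed
    show "Z s \<in> borel_measurable M" using Z st by (auto simp: martingale_def)
  qed (use A sets_F_subset in auto)
  finally show ?thesis by simp
qed

lemma martingaleI:
  assumes "\<And>t. 0 \<le> t \<Longrightarrow> Z t \<in> borel_measurable (F (ennreal t))"
    and "\<And>t. 0 \<le> t \<Longrightarrow> integrable M (Z t)"
    and "\<And>s t A. 0 \<le> s \<Longrightarrow> s \<le> t \<Longrightarrow> A \<in> sets (F (ennreal s)) \<Longrightarrow>
           (LINT \<omega>:A|M. Z t \<omega>) = (LINT \<omega>:A|M. Z s \<omega>)"
  shows "martingale M F Z"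
  unfolding martingale_def
proof (intro conjI allI impI)
  fix s t :: real assume st: "0 \<le> s \<and> s \<le> t"
  interpret S: finite_measure_subalgebra M "F (ennreal s)" by (rule finite_measure_subalgebra_F)
  show "AE \<omega> in M. real_cond_exp M (F (ennreal s)) (Z t) \<omega> = Z s \<omega>"
    by (rule S.real_cond_exp_charact) (use assms st in auto)
qed (use assms in auto)

text \<open>Sampling at grid times makes \<open>T\<close> finitely valued. Each event
  \<open>A k\<close>, on which the sampled time is \<open>q k\<close>, is known at time
  \<open>q k\<close>, so the martingale property replaces Z(q k) by Z(N) there. Summing gives the
  equality for every grid, and the bound \<open>K\<close> carries it to the limit.\<close>

lemma optional_stopping_bounded:
  assumes Z: "martingale M F Z"
    and rc: "\<And>\<omega> s. \<omega> \<in> space M \<Longrightarrow> 0 \<le> s \<Longrightarrow> ((\<lambda>s. Z s \<omega>) \<longlongrightarrow> Z s \<omega>) (at_right s)"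
    and T: "stopping_time F T" and TN: "\<And>\<omega>. \<omega> \<in> space M \<Longrightarrow> T \<omega> \<le> ennreal N" and N: "0 \<le> N"
    and bound: "\<And>\<omega> t. \<omega> \<in> space M \<Longrightarrow> 0 \<le> t \<Longrightarrow> t \<le> N \<Longrightarrow> \<bar>Z t \<omega>\<bar> \<le> K"
  shows "expectation (\<lambda>\<omega>. Z (enn2real (T \<omega>)) \<omega>) = expectation (Z N)"
proof -
  define R where "R \<omega> = enn2real (T \<omega>)" for \<omega>
  have TM[measurable]: "T \<in> borel_measurable M" by (rule stopping_time_measurable[OF T])
  have R_range: "0 \<le> R \<omega>" "R \<omega> \<le> N" if "\<omega> \<in> space M" for \<omega>
    using TN[OF that] N by (auto simp: R_def intro: enn2real_leI)
  have TR: "T \<omega> = ennreal (R \<omega>)" if "\<omega> \<in> space M" for \<omega>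
    using le_less_trans[OF TN[OF that] ennreal_less_top] by (simp add: R_def ennreal_enn2real)
  have ZM: "Z t \<in> borel_measurable M" if "0 \<le> t" for t
    using Z that by (auto simp: martingale_def intro: measurable_F)
  have int_Z: "integrable M (Z t)" if "0 \<le> t" for t
    using Z that by (auto simp: martingale_def)
  have RM[measurable]: "R \<in> borel_measurable M" by (simp add: R_def[abs_def])
  define V where "V n \<omega> = Z (min N (grid_above n (R \<omega>))) \<omega>" for n \<omega>
  have V_eq: "integrable M (V n) \<and> expectation (V n) = expectation (Z N)" for n
  proof -
    define m where "m = real (Suc n)"
    have m: "0 < m" by (simp add: m_def)
    define I where "I = {0..\<lfloor>m * N\<rfloor>}"
    define q where "q k = min N ((real_of_int k + 1) / m)" for k :: int
    define A where "A k = {\<omega> \<in> space M. \<lfloor>m * R \<omega>\<rfloor> = k}" for k :: int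
    have finI: "finite I" by (simp add: I_def)
    have q: "0 \<le> q k" "q k \<le> N" if "k \<in> I" for k
      using that N m by (auto simp: q_def I_def)
    have A_F: "A k \<in> sets (F (ennreal (q k)))" if k: "k \<in> I" for k
    proof -
      have k0: "0 \<le> k" "real_of_int k \<le> m * N" using k by (auto simp: I_def le_floor_iff)
      have kN: "real_of_int k / m \<le> q k" using k0 m by (auto simp: q_def field_simps)
      have "A k = {\<omega> \<in> space M. T \<omega> < ennreal ((real_of_int k + 1) / m)} - {\<omega> \<in> space M. T \<omega> < ennreal (real_of_int k / m)}"
      proof (intro set_eqI)
        fix \<omega>
        have "(\<lfloor>m * R \<omega>\<rfloor> = k) = (T \<omega> < ennreal ((real_of_int k + 1) / m) \<and> \<not> T \<omega> < ennreal (real_of_int k / m))"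
          if \<omega>: "\<omega> \<in> space M"
          using TR[OF \<omega>] R_range[OF \<omega>] k0 m
          by (auto simp: floor_eq_iff ennreal_less_iff field_simps)
        then show "(\<omega> \<in> A k) = (\<omega> \<in> {\<omega> \<in> space M. T \<omega> < ennreal ((real_of_int k + 1) / m)} - {\<omega> \<in> space M. T \<omega> < ennreal (real_of_int k / m)})"
          by (auto simp: A_def)
      qed
      also have "\<dots> \<in> sets (F (ennreal (q k)))"
      proof (rule sets.Diff)
        show "{\<omega> \<in> space M. T \<omega> < ennreal (real_of_int k / m)} \<in> sets (F (ennreal (q k)))"
          using stopping_time_less_const[OF T, of "ennreal (real_of_int k / m)"]
            sets_F_mono[OF ennreal_leI[OF kN]] by (auto simp: Measurable.pred_def space_F)
        show "{\<omega> \<in> space M. T \<omega> < ennreal ((real_of_int k + 1) / m)} \<in> sets (F (ennreal (q k)))"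
        \<comment> \<open>In the last cell \<open>q k\<close> is cut to \<open>N\<close>, possibly
          earlier than the endpoint (k+1)/m; in that case T \<le> N makes the strict upper bound
          automatic.\<close>
        proof (cases "(real_of_int k + 1) / m \<le> N")
          case True
          then have "q k = (real_of_int k + 1) / m" by (simp add: q_def)
          then show ?thesis
            using stopping_time_less_const[OF T, of "ennreal ((real_of_int k + 1) / m)"]
            by (auto simp: Measurable.pred_def space_F)
        next
          case False
          then have "ennreal N < ennreal ((real_of_int k + 1) / m)" using N by (simp add: ennreal_less_iff)
          then have "{\<omega> \<in> space M. T \<omega> < ennreal ((real_of_int k + 1) / m)} = space (F (ennreal (q k)))"
            using TN by (auto simp: space_F intro: le_less_trans)
          then show ?thesis by simp
        qed
      qed
      finally show ?thesis .
    qed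
    have AM: "A k \<in> sets M" for k by (simp add: A_def)
    have R_I: "\<lfloor>m * R \<omega>\<rfloor> \<in> I" if "\<omega> \<in> space M" for \<omega>
      using R_range[OF that] m by (auto simp: I_def intro!: floor_mono mult_left_mono)
    have sum_ind: "(\<Sum>k\<in>I. indicator (A k) \<omega> * g k) = g \<lfloor>m * R \<omega>\<rfloor>" if \<omega>: "\<omega> \<in> space M" for \<omega> and g :: "int \<Rightarrow> real"
    proof -
      have "(\<Sum>k\<in>I. indicator (A k) \<omega> * g k) = (\<Sum>k\<in>I. if \<lfloor>m * R \<omega>\<rfloor> = k then g k else 0)"
        by (intro sum.cong) (auto simp: A_def \<omega> indicator_def)
      also have "\<dots> = g \<lfloor>m * R \<omega>\<rfloor>" using R_I[OF \<omega>] finI by (simp add: sum.delta')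
      finally show ?thesis .
    qed
    have V_sum: "V n \<omega> = (\<Sum>k\<in>I. indicator (A k) \<omega> * Z (q k) \<omega>)" if \<omega>: "\<omega> \<in> space M" for \<omega>
      using sum_ind[OF \<omega>, of "\<lambda>k. Z (q k) \<omega>"] by (simp add: V_def q_def grid_above_def m_def)
    have int_ind: "integrable M (\<lambda>\<omega>. indicator (A k) \<omega> * Z r \<omega>)" if "0 \<le> r" for k r
      using integrable_mult_indicator[OF AM[of k] int_Z[OF that]] by simp
    have int_V: "integrable M (V n)"
      by (subst Bochner_Integration.integrable_cong[OF refl V_sum])
        (auto intro!: Bochner_Integration.integrable_sum int_ind q)
    have "expectation (V n) = expectation (\<lambda>\<omega>. \<Sum>k\<in>I. indicator (A k) \<omega> * Z (q k) \<omega>)"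
      by (rule Bochner_Integration.integral_cong) (auto simp: V_sum)
    also have "\<dots> = (\<Sum>k\<in>I. expectation (\<lambda>\<omega>. indicator (A k) \<omega> * Z (q k) \<omega>))"
      by (rule Bochner_Integration.integral_sum) (auto intro!: int_ind q)
    also have "\<dots> = (\<Sum>k\<in>I. expectation (\<lambda>\<omega>. indicator (A k) \<omega> * Z N \<omega>))"
      using martingale_set_integral[OF Z q A_F]
      by (intro sum.cong) (auto simp: set_lebesgue_integral_def)
    also have "\<dots> = expectation (\<lambda>\<omega>. \<Sum>k\<in>I. indicator (A k) \<omega> * Z N \<omega>)"
      by (rule Bochner_Integration.integral_sum[symmetric]) (auto intro!: int_ind N)
    also have "\<dots> = expectation (Z N)"
      by (rule Bochner_Integration.integral_cong) (auto simp: sum_ind)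
    finally show ?thesis using int_V by simp
  qed
  have "(\<lambda>n. expectation (V n)) \<longlonglongrightarrow> expectation (\<lambda>\<omega>. Z (R \<omega>) \<omega>)"
  proof (rule integral_dominated_convergence[where w="\<lambda>_. K"])
    show "(\<lambda>\<omega>. Z (R \<omega>) \<omega>) \<in> borel_measurable M"
      by (rule measurable_compose_right_continuous[where t=N]) (auto simp: R_range ZM rc)
    show "V n \<in> borel_measurable M" for n using V_eq[of n] by auto
    show "AE \<omega> in M. (\<lambda>n. V n \<omega>) \<longlonglongrightarrow> Z (R \<omega>) \<omega>"
      unfolding V_def
      by (intro AE_I2 tendsto_min_grid_above[where w="\<lambda>s. Z s _"] rc R_range) auto
    show "AE \<omega> in M. norm (V n \<omega>) \<le> K" for n
    proof (rule AE_I2)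
      fix \<omega> assume \<omega>: "\<omega> \<in> space M"
      show "norm (V n \<omega>) \<le> K"
        using R_range[OF \<omega>] grid_above_gt[of "R \<omega>" n] N unfolding V_def real_norm_def
        by (intro bound[OF \<omega>]) auto
    qed
  qed simp
  then have "(\<lambda>n::nat. expectation (Z N)) \<longlonglongrightarrow> expectation (\<lambda>\<omega>. Z (R \<omega>) \<omega>)"
    using V_eq by simp
  from LIMSEQ_unique[OF this tendsto_const] show ?thesis by (simp add: R_def)
qed

text \<open>Stopping at min(n,T) is the bounded case. Since |Z| grows at most linearly, all these
  values are dominated almost surely by a + c T, which is integrable because \<open>T\<close> has
  finite mean.\<close>

lemma optional_stopping:
  assumes Z: "martingale M F Z"
    and rc: "\<And>\<omega> s. \<omega> \<in> space M \<Longrightarrow> 0 \<le> s \<Longrightarrow> ((\<lambda>s. Z s \<omega>) \<longlongrightarrow> Z s \<omega>) (at_right s)"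
    and T: "stopping_time F T" and T_fin: "(\<integral>\<^sup>+\<omega>. T \<omega> \<partial>M) < \<infinity>"
    and ac: "0 \<le> a" "0 \<le> c"
    and bound: "\<And>\<omega> t. \<omega> \<in> space M \<Longrightarrow> 0 \<le> t \<Longrightarrow> \<bar>Z t \<omega>\<bar> \<le> a + c * t"
  shows "integrable M (\<lambda>\<omega>. Z (enn2real (T \<omega>)) \<omega>)"
    and "expectation (\<lambda>\<omega>. Z (enn2real (T \<omega>)) \<omega>) = expectation (Z 0)"
proof -
  have TM[measurable]: "T \<in> borel_measurable M" by (rule stopping_time_measurable[OF T])
  have ZM: "Z t \<in> borel_measurable M" if "0 \<le> t" for t
    using Z that by (auto simp: martingale_def intro: measurable_F)
  have T_int: "integrable M (\<lambda>\<omega>. enn2real (T \<omega>))"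
  proof (rule integrableI_bounded)
    have "(\<integral>\<^sup>+\<omega>. ennreal (norm (enn2real (T \<omega>))) \<partial>M) \<le> (\<integral>\<^sup>+\<omega>. T \<omega> \<partial>M)"
      by (intro nn_integral_mono) (auto simp: ennreal_enn2real_if)
    then show "(\<integral>\<^sup>+\<omega>. ennreal (norm (enn2real (T \<omega>))) \<partial>M) < \<infinity>"
      using T_fin by (rule le_less_trans)
  qed simp
  have dom: "integrable M (\<lambda>\<omega>. a + c * enn2real (T \<omega>))" using T_int by auto
  have ZT[measurable]: "(\<lambda>\<omega>. Z (enn2real (T \<omega>)) \<omega>) \<in> borel_measurable M"
    by (rule measurable_compose_right_continuous_unbounded) (auto simp: ZM rc)
  show "integrable M (\<lambda>\<omega>. Z (enn2real (T \<omega>)) \<omega>)"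
    by (rule Bochner_Integration.integrable_bound[OF dom])
      (auto intro!: AE_I2 order_trans[OF bound] simp: ac)
  have T_top: "AE \<omega> in M. T \<omega> \<noteq> \<infinity>"
    by (rule nn_integral_PInf_AE) (use T_fin in auto)
  have stop_N: "expectation (\<lambda>\<omega>. Z (enn2real (min (ennreal (real n)) (T \<omega>))) \<omega>) = expectation (Z 0)" for n
  proof -
    have "expectation (\<lambda>\<omega>. Z (enn2real (min (ennreal (real n)) (T \<omega>))) \<omega>) = expectation (Z (real n))"
    proof (rule optional_stopping_bounded[OF Z rc])
      show "stopping_time F (\<lambda>\<omega>. min (ennreal (real n)) (T \<omega>))"
        by (intro stopping_time_min stopping_time_const T)
      show "\<bar>Z t \<omega>\<bar> \<le> a + c * real n" if "\<omega> \<in> space M" "0 \<le> t" "t \<le> real n" for \<omega> t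
        using bound[OF that(1,2)] mult_left_mono[OF that(3) ac(2)] by linarith
    qed auto
    also have "\<dots> = expectation (Z 0)"
      using martingale_set_integral[OF Z, of 0 "real n" "space M"] sets.top[of "F (ennreal 0)"]
      by (simp add: set_integral_space space_F set_lebesgue_integral_def cong: Bochner_Integration.integral_cong)
    finally show ?thesis .
  qed
  have "(\<lambda>n. expectation (\<lambda>\<omega>. Z (enn2real (min (ennreal (real n)) (T \<omega>))) \<omega>)) \<longlonglongrightarrow>
      expectation (\<lambda>\<omega>. Z (enn2real (T \<omega>)) \<omega>)"
  proof (rule integral_dominated_convergence[OF ZT _ dom])
    show "(\<lambda>\<omega>. Z (enn2real (min (ennreal (real n)) (T \<omega>))) \<omega>) \<in> borel_measurable M" for n
      by (rule measurable_compose_right_continuous_unbounded) (auto simp: ZM rc)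
    show "AE \<omega> in M. (\<lambda>n. Z (enn2real (min (ennreal (real n)) (T \<omega>))) \<omega>) \<longlonglongrightarrow> Z (enn2real (T \<omega>)) \<omega>"
      using T_top
    proof eventually_elim
      fix \<omega> assume "T \<omega> \<noteq> \<infinity>"
      then obtain r where r: "T \<omega> = ennreal r" "0 \<le> r" by (cases "T \<omega>") auto
      have "eventually (\<lambda>n. r \<le> real n) sequentially"
        by (meson eventually_sequentiallyI of_nat_mono order_trans real_arch_simple)
      then have "eventually (\<lambda>n. Z (enn2real (min (ennreal (real n)) (T \<omega>))) \<omega> = Z (enn2real (T \<omega>)) \<omega>) sequentially"
        by eventually_elim (simp add: r min_def ennreal_leI)
      then show "(\<lambda>n. Z (enn2real (min (ennreal (real n)) (T \<omega>))) \<omega>) \<longlonglongrightarrow> Z (enn2real (T \<omega>)) \<omega>"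
        by (rule tendsto_eventually)
    qed
    show "AE \<omega> in M. norm (Z (enn2real (min (ennreal (real n)) (T \<omega>))) \<omega>) \<le> a + c * enn2real (T \<omega>)" for n
      using T_top
    \<comment> \<open>Domination can fail where \<open>T\<close> is infinite, because
      \<open>enn2real\<close> gives 0 there while the stopped time is \<open>n\<close>; that set is
      null.\<close>
    proof (rule AE_mp, intro AE_I2 impI)
      fix \<omega> assume \<omega>: "\<omega> \<in> space M" and top: "T \<omega> \<noteq> \<infinity>"
      have "enn2real (min (ennreal (real n)) (T \<omega>)) \<le> enn2real (T \<omega>)"
        using top by (intro enn2real_mono) (auto simp: less_top)
      from mult_left_mono[OF this ac(2)] bound[OF \<omega>, of "enn2real (min (ennreal (real n)) (T \<omega>))"]
      show "norm (Z (enn2real (min (ennreal (real n)) (T \<omega>))) \<omega>) \<le> a + c * enn2real (T \<omega>)" by simp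
    qed
  qed
  then show "expectation (\<lambda>\<omega>. Z (enn2real (T \<omega>)) \<omega>) = expectation (Z 0)"
    unfolding stop_N using LIMSEQ_unique[OF _ tendsto_const] by blast
qed

text \<open>To test the martingale property of the stopped process on \<open>A \<in> F s\<close>, compare \<open>T \<and> t\<close> with the
  stopping time that equals \<open>s\<close> on \<open>A \<inter> {s < T}\<close> and \<open>T \<and> t\<close> elsewhere.\<close>

lemma stopped_martingaleI:
  assumes Z: "\<And>t. 0 \<le> t \<Longrightarrow> Z t \<in> borel_measurable (F (ennreal t))"
    and rc: "\<And>\<omega> s. \<omega> \<in> space M \<Longrightarrow> 0 \<le> s \<Longrightarrow> ((\<lambda>s. Z s \<omega>) \<longlongrightarrow> Z s \<omega>) (at_right s)"
    and T: "stopping_time F T"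
    and int: "\<And>S. stopping_time F S \<Longrightarrow> (\<And>\<omega>. \<omega> \<in> space M \<Longrightarrow> S \<omega> \<noteq> \<infinity> \<and> S \<omega> \<le> T \<omega>) \<Longrightarrow>
           integrable M (\<lambda>\<omega>. Z (enn2real (S \<omega>)) \<omega>) \<and> expectation (\<lambda>\<omega>. Z (enn2real (S \<omega>)) \<omega>) = C"
  shows "martingale M F (stopped Z T)"
proof (rule martingaleI)
  show "stopped Z T t \<in> borel_measurable (F (ennreal t))" if "0 \<le> t" for t
    by (rule stopped_measurable[OF T that]) (auto intro: Z rc)
  have int_t: "integrable M (stopped Z T t) \<and> expectation (stopped Z T t) = C" for t
    unfolding stopped_def[abs_def]
  proof (rule int)
    show "stopping_time F (\<lambda>\<omega>. min (ennreal t) (T \<omega>))" by (intro stopping_time_min stopping_time_const T)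
  qed (auto simp: min_def top_unique)
  then show "integrable M (stopped Z T t)" for t by auto
  fix s t :: real and A assume st: "0 \<le> s" "s \<le> t" and A: "A \<in> sets (F (ennreal s))"
  define A' where "A' = A \<inter> {\<omega> \<in> space M. ennreal s < T \<omega>}"
  have A': "A' \<in> sets (F (ennreal s))"
    using A stopping_timeD2[OF T, of "ennreal s"] by (auto simp: A'_def Measurable.pred_def space_F)
  define S where "S \<omega> = (if \<omega> \<in> A' then ennreal s else min (ennreal t) (T \<omega>))" for \<omega>
  have "stopping_time F S"
  proof (rule stopping_timeI)
    fix r
    show "Measurable.pred (F r) (\<lambda>\<omega>. S \<omega> \<le> r)"
    proof (cases "ennreal s \<le> r")
      \<comment> \<open>For r < s neither inequality can hold on \<open>A'\<close>: there S = s, and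
        both \<open>t\<close> and \<open>T\<close> are at least \<open>s\<close>.\<close>
      case False
      then have "(S \<omega> \<le> r) = (min (ennreal t) (T \<omega>) \<le> r)" for \<omega>
        using ennreal_leI[OF st(2)] by (auto simp: S_def A'_def min_def)
      then show ?thesis
        using stopping_timeD[OF stopping_time_min[OF stopping_time_const[of F "ennreal t"] T], of r] by simp
    next
      case True
      then have "(S \<omega> \<le> r) = (\<omega> \<in> A' \<or> min (ennreal t) (T \<omega>) \<le> r)" for \<omega>
        by (auto simp: S_def)
      moreover have "Measurable.pred (F r) (\<lambda>\<omega>. \<omega> \<in> A')"
        using A' sets_F_mono[OF True] by (auto simp: Measurable.pred_def Collect_conj_eq intro!: sets.Int)
      ultimately show ?thesis
        using stopping_timeD[OF stopping_time_min[OF stopping_time_const[of F "ennreal t"] T], of r]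
        by (auto intro!: pred_intros_logic)
    qed
  qed
  moreover have "S \<omega> \<noteq> \<infinity> \<and> S \<omega> \<le> T \<omega>" if "\<omega> \<in> space M" for \<omega>
    by (auto simp: S_def A'_def min_def top_unique)
  ultimately have S: "integrable M (\<lambda>\<omega>. Z (enn2real (S \<omega>)) \<omega>)"
      "expectation (\<lambda>\<omega>. Z (enn2real (S \<omega>)) \<omega>) = C"
    using int by auto
  \<comment> \<open>On \<open>A\<close> outside \<open>A'\<close> one has T \<le> s \<le> t, so the
    stopped values at \<open>s\<close> and at \<open>t\<close> agree and the two indicator terms
    cancel.\<close>
  have "Z (enn2real (S \<omega>)) \<omega> = stopped Z T t \<omega> - indicator A \<omega> * stopped Z T t \<omega> + indicator A \<omega> * stopped Z T s \<omega>"
    if "\<omega> \<in> space M" for \<omega>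
    using that ennreal_leI[OF st(2)] by (auto simp: S_def A'_def stopped_def indicator_def min_def st)
  then have "C = expectation (\<lambda>\<omega>. stopped Z T t \<omega> - indicator A \<omega> * stopped Z T t \<omega> + indicator A \<omega> * stopped Z T s \<omega>)"
    unfolding S(2)[symmetric] by (intro Bochner_Integration.integral_cong) auto
  also have "\<dots> = C - expectation (\<lambda>\<omega>. indicator A \<omega> * stopped Z T t \<omega>) + expectation (\<lambda>\<omega>. indicator A \<omega> * stopped Z T s \<omega>)"
    using integrable_mult_indicator[OF sets_F_subset[OF A] int_t[THEN conjunct1]] int_t by simp
  finally show "(LINT \<omega>:A|M. stopped Z T t \<omega>) = (LINT \<omega>:A|M. stopped Z T s \<omega>)"
    by (simp add: set_lebesgue_integral_def)
qed

end

section \<open>The inverse of a Lipschitz clock\<close>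

text \<open>Serves three measures, Lebesgue, \<open>stieltjes\<close> and \<open>L1\<close>: nested
  intervals give Lipschitz estimates in the upper limit, and \<open>A\<close> empty gives a bound
  for the integral itself.\<close>

lemma set_integral_increment_bound:
  fixes h :: "'a \<Rightarrow> real"
  assumes AB: "A \<subseteq> B" "A \<in> sets \<mu>" "B \<in> sets \<mu>" and fin: "emeasure \<mu> B < \<infinity>"
    and h: "set_borel_measurable \<mu> B h" and K: "\<And>x. x \<in> B \<Longrightarrow> \<bar>h x\<bar> \<le> K"
  shows "set_integrable \<mu> B h"
    and "\<bar>(LINT x:B|\<mu>. h x) - (LINT x:A|\<mu>. h x)\<bar> \<le> K * measure \<mu> (B - A)"
proof -
  have intB: "integrable \<mu> (indicat_real B)"
    using AB fin by (intro integrable_real_indicator) auto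
  then have intBK: "integrable \<mu> (\<lambda>x. indicat_real B x * K)" by auto
  show int: "set_integrable \<mu> B h"
    unfolding set_integrable_def
    by (rule Bochner_Integration.integrable_bound[OF intBK])
      (use h in \<open>auto simp: set_borel_measurable_def indicator_def intro!: AE_I2 order_trans[OF K]\<close>)
  have D: "B - A \<in> sets \<mu>" using AB by auto
  have intA: "set_integrable \<mu> A h" and intD: "set_integrable \<mu> (B - A) h"
    using set_integrable_subset[OF int] AB D by auto
  have "(LINT x:B|\<mu>. h x) = (LINT x:A|\<mu>. h x) + (LINT x:B - A|\<mu>. h x)"
    using set_integral_Un[OF _ intA intD] AB(1) by (simp add: Un_absorb1 Diff_partition)
  then have "\<bar>(LINT x:B|\<mu>. h x) - (LINT x:A|\<mu>. h x)\<bar> = norm (LINT x:B - A|\<mu>. h x)" by simp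
  also have "\<dots> \<le> (LINT x|\<mu>. norm (indicat_real (B - A) x *\<^sub>R h x))"
    unfolding set_lebesgue_integral_def by (rule integral_norm_bound)
  also have "\<dots> \<le> (LINT x|\<mu>. indicat_real (B - A) x * K)"
  proof (rule integral_mono)
    show "integrable \<mu> (\<lambda>x. norm (indicat_real (B - A) x *\<^sub>R h x))"
      using intD unfolding set_integrable_def by (rule integrable_norm)
    have "emeasure \<mu> (B - A) \<le> emeasure \<mu> B" using AB by (intro emeasure_mono) auto
    then show "integrable \<mu> (\<lambda>x. indicat_real (B - A) x * K)"
      using D fin by (intro integrable_mult_left integrable_real_indicator) (auto intro: le_less_trans)
  qed (auto simp: indicator_def K)
  also have "\<dots> = K * measure \<mu> (B - A)"
    using D sets.sets_into_space[OF D] by (simp add: mult.commute inf.absorb1)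
  finally show "\<bar>(LINT x:B|\<mu>. h x) - (LINT x:A|\<mu>. h x)\<bar> \<le> K * measure \<mu> (B - A)" .
qed

lemma tendsto_at_right_Lipschitz:
  fixes J :: "real \<Rightarrow> real"
  assumes "\<And>t. s \<le> t \<Longrightarrow> \<bar>J t - J s\<bar> \<le> K * (t - s)"
  shows "(J \<longlongrightarrow> J s) (at_right s)"
proof (rule LIM_zero_cancel, rule Lim_null_comparison)
  show "eventually (\<lambda>t. norm (J t - J s) \<le> K * (t - s)) (at_right s)"
    using assms by (auto simp: eventually_at_right_field intro!: exI[of _ "s + 1"])
  have "((\<lambda>t. K * (t - s)) \<longlongrightarrow> K * (s - s)) (at_right s)"
    by (intro tendsto_intros)
  then show "((\<lambda>t. K * (t - s)) \<longlongrightarrow> 0) (at_right s)" by simp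
qed

locale clock_path =
  fixes l :: "real \<Rightarrow> real"
  assumes l_0: "l 0 = 0"
    and l_mono: "\<And>s t. 0 \<le> s \<Longrightarrow> s \<le> t \<Longrightarrow> l s \<le> l t"
    and l_Lipschitz: "\<And>s t. 0 \<le> s \<Longrightarrow> s \<le> t \<Longrightarrow> l t - l s \<le> t - s"
begin

text \<open>This is \<open>inverse_clock\<close> along one fixed path. Its real version
  \<open>tr\<close> is 0 where \<open>icl\<close> is infinite, so finiteness of \<open>icl\<close>
  has to be assumed or proved wherever \<open>tr\<close> acts as an inverse.\<close>

definition icl :: "ennreal \<Rightarrow> ennreal" where
  "icl t = (INF s\<in>{s. 0 \<le> s \<and> t < ennreal (l s)}. ennreal s)"

definition tr :: "real \<Rightarrow> real" where
  "tr t = enn2real (icl (ennreal t))"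

lemma l_nonneg: "0 \<le> s \<Longrightarrow> 0 \<le> l s"
  using l_mono[of 0 s] l_0 by simp

lemma l_le: "0 \<le> s \<Longrightarrow> l s \<le> s"
  using l_Lipschitz[of 0 s] l_0 by simp

lemma icl_mono: "s \<le> t \<Longrightarrow> icl s \<le> icl t"
  unfolding icl_def by (rule INF_superset_mono) auto

text \<open>If t < l s, the Lipschitz bound leaves t < l (s - e) for small \<open>e\<close>, so the
  infimum is at most s - e and the inequality stays strict. Half the gap between t and l s, cut at
  \<open>s\<close>, is such an \<open>e\<close> and keeps s - e nonnegative.\<close>

lemma icl_less_iff:
  assumes s: "0 \<le> s"
  shows "icl t < ennreal s \<longleftrightarrow> t < ennreal (l s)"
proof
  assume "icl t < ennreal s"
  then obtain r where r: "0 \<le> r" "t < ennreal (l r)" "ennreal r < ennreal s"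
    unfolding icl_def INF_less_iff by auto
  then have "l r \<le> l s" using s by (intro l_mono) (auto simp: ennreal_less_iff)
  with r(2) show "t < ennreal (l s)" by (meson ennreal_leI less_le_trans)
next
  assume t: "t < ennreal (l s)"
  then obtain t' where t': "t = ennreal t'" "0 \<le> t'" by (cases t) auto
  with t s have tl: "t' < l s" by (simp add: ennreal_less_iff)
  with t' l_le[OF s] have spos: "0 < s" by linarith
  define e where "e = min s ((l s - t') / 2)"
  have e: "0 < e" "e \<le> s" "e < l s - t'" using tl spos by (auto simp: e_def min_def)
  have "l s - l (s - e) \<le> e" using l_Lipschitz[of "s - e" s] e by auto
  then have "t' < l (s - e)" using e by linarith
  then have "icl t \<le> ennreal (s - e)"
    unfolding icl_def using t' e by (intro INF_lower) (auto simp: ennreal_less_iff)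
  also have "\<dots> < ennreal s" using e spos by (simp add: ennreal_less_iff)
  finally show "icl t < ennreal s" .
qed

lemma icl_eq_top_mono: "icl s = \<infinity> \<Longrightarrow> s \<le> t \<Longrightarrow> icl t = \<infinity>"
  using icl_mono[of s t] by (simp add: top_unique)

lemma icl_tr: "icl (ennreal t) \<noteq> \<infinity> \<Longrightarrow> icl (ennreal t) = ennreal (tr t)"
  by (simp add: tr_def ennreal_enn2real_if)

lemma tr_nonneg: "0 \<le> tr t"
  by (simp add: tr_def)

text \<open>By \<open>icl_less_iff\<close> the clock has not passed \<open>t\<close> at time
  \<open>tr t\<close>, but has passed it at every later time; the Lipschitz bound closes the
  gap.\<close>

lemma l_tr:
  assumes t: "0 \<le> t" and fin: "icl (ennreal t) \<noteq> \<infinity>"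
  shows "l (tr t) = t"
proof (rule antisym)
  show "l (tr t) \<le> t"
    using icl_less_iff[of "tr t" "ennreal t"] icl_tr[OF fin] t tr_nonneg[of t]
    by (auto simp: ennreal_less_iff not_less)
  show "t \<le> l (tr t)"
  proof (rule field_le_epsilon)
    fix e :: real assume e: "0 < e"
    have "icl (ennreal t) < ennreal (tr t + e)"
      using e tr_nonneg[of t] by (simp add: icl_tr[OF fin] ennreal_less_iff)
    then have "t < l (tr t + e)"
      using e tr_nonneg[of t] t by (subst (asm) icl_less_iff) (auto simp: ennreal_less_iff)
    then show "t \<le> l (tr t) + e"
      using l_Lipschitz[of "tr t" "tr t + e"] e tr_nonneg[of t] by linarith
  qed
qed

lemma tr_mono:
  assumes "0 \<le> s" "s \<le> t" and fin: "icl (ennreal t) \<noteq> \<infinity>"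
  shows "tr s \<le> tr t"
  unfolding tr_def using fin by (intro enn2real_mono icl_mono ennreal_leI assms) (auto simp: less_top)

text \<open>Since \<open>l\<close> inverts \<open>tr\<close> from the left, \<open>tr\<close> is
  injective where \<open>icl\<close> is finite. Flat stretches of \<open>l\<close> turn into jumps
  of \<open>tr\<close>.\<close>

lemma tr_strict_mono:
  assumes "0 \<le> s" "s < t" and fin: "icl (ennreal t) \<noteq> \<infinity>"
  shows "tr s < tr t"
proof -
  have "icl (ennreal s) \<noteq> \<infinity>"
    using icl_eq_top_mono[of "ennreal s" "ennreal t"] fin assms by (auto intro: ennreal_leI)
  then have "tr s \<noteq> tr t" using l_tr[of s] l_tr[of t] assms by auto
  with tr_mono[of s t] assms show ?thesis by auto
qed

lemma tr_less:
  assumes "0 \<le> t" "0 \<le> s" "t < l s"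
  shows "icl (ennreal t) \<noteq> \<infinity>" "tr t < s"
proof -
  have *: "icl (ennreal t) < ennreal s" using assms by (subst icl_less_iff) (auto simp: ennreal_less_iff)
  then show fin: "icl (ennreal t) \<noteq> \<infinity>" by auto
  from * show "tr t < s" unfolding icl_tr[OF fin] by (simp add: ennreal_less_iff tr_nonneg)
qed

text \<open>Strict monotonicity makes the approach to \<open>tr t\<close> strictly from the right,
  so right limits of a path compose with \<open>tr\<close>. The neighbourhood is (t, l (tr t + e)),
  on which \<open>tr_less\<close> both excludes infinite values and bounds \<open>tr\<close> by tr t
  + e.\<close>

lemma filterlim_tr_at_right:
  assumes t: "0 \<le> t" and fin: "icl (ennreal t) \<noteq> \<infinity>"
  shows "eventually (\<lambda>s. icl (ennreal s) \<noteq> \<infinity>) (at_right t)"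
    and "filterlim tr (at_right (tr t)) (at_right t)"
proof -
  have near: "eventually (\<lambda>s. icl (ennreal s) \<noteq> \<infinity> \<and> tr t < tr s \<and> tr s < tr t + e) (at_right t)"
    if e: "0 < e" for e
  proof -
    have "icl (ennreal t) < ennreal (tr t + e)"
      using e tr_nonneg[of t] by (simp add: icl_tr[OF fin] ennreal_less_iff)
    then have tl: "t < l (tr t + e)"
      using e tr_nonneg[of t] t by (subst (asm) icl_less_iff) (auto simp: ennreal_less_iff)
    show ?thesis unfolding eventually_at_right_field
    proof (intro exI[of _ "l (tr t + e)"] conjI allI impI tl)
      fix s assume s: "t < s" "s < l (tr t + e)"
      with tr_less[of s "tr t + e"] tr_strict_mono[of t s] t e tr_nonneg[of t]
      show "icl (ennreal s) \<noteq> \<infinity>" "tr t < tr s" "tr s < tr t + e" by auto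
    qed
  qed
  show "eventually (\<lambda>s. icl (ennreal s) \<noteq> \<infinity>) (at_right t)"
    using near[of 1] by (auto elim: eventually_mono)
  show "filterlim tr (at_right (tr t)) (at_right t)"
  proof (rule filterlim_at_withinI)
    show "(tr \<longlongrightarrow> tr t) (at_right t)"
    proof (rule tendstoI)
      fix e :: real assume "0 < e"
      from near[OF this] show "eventually (\<lambda>s. dist (tr s) (tr t) < e) (at_right t)"
        by eventually_elim (auto simp: dist_real_def)
    qed
    show "eventually (\<lambda>s. tr s \<in> {tr t<..} - {tr t}) (at_right t)"
      using near[of 1] by (auto elim: eventually_mono)
  qed
qed

text \<open>The default \<open>c\<close> is absorbing, since \<open>icl\<close> stays infinite once
  it is. It is instantiated with \<open>Y\<close> at time 0 and with the control integral over
  [0,\<infinity>).\<close>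

lemma right_continuous_time_change:
  assumes t: "0 \<le> t" and w: "\<And>r. 0 \<le> r \<Longrightarrow> (w \<longlongrightarrow> w r) (at_right r)"
  shows "((\<lambda>s. if icl (ennreal s) = \<infinity> then c else w (tr s)) \<longlongrightarrow>
      (if icl (ennreal t) = \<infinity> then c else w (tr t))) (at_right t)"
proof (cases "icl (ennreal t) = \<infinity>")
  case True
  have "eventually (\<lambda>s. (if icl (ennreal s) = \<infinity> then c else w (tr s)) = c) (at_right t)"
    unfolding eventually_at_right_field
    using icl_eq_top_mono[OF True] by (intro exI[of _ "t + 1"]) (auto simp: ennreal_leI)
  then show ?thesis using True by (simp add: tendsto_eventually)
next
  case False
  have "((\<lambda>s. w (tr s)) \<longlongrightarrow> w (tr t)) (at_right t)"
    by (rule filterlim_compose[OF w[OF tr_nonneg] filterlim_tr_at_right(2)[OF t False]])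
  moreover have "eventually (\<lambda>s. w (tr s) = (if icl (ennreal s) = \<infinity> then c else w (tr s))) (at_right t)"
    using filterlim_tr_at_right(1)[OF t False] by eventually_elim simp
  ultimately show ?thesis using False by (simp add: Lim_transform_eventually)
qed

text \<open>\<open>b\<close> is the left limit of \<open>tr\<close> at \<open>t\<close>, possibly
  smaller than \<open>tr t\<close>. Strict monotonicity keeps \<open>tr\<close> below
  \<open>b\<close> before \<open>t\<close>, so the left limit of a path at \<open>b\<close> becomes
  the left limit of the time-changed path at \<open>t\<close>.\<close>

lemma filterlim_tr_at_left:
  assumes t: "0 < t" and fin: "icl (ennreal t) \<noteq> \<infinity>"
  obtains b where "0 < b" "filterlim tr (at_left b) (at_left t)"
proof -
  define b where "b = (SUP s\<in>{0..<t}. tr s)"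
  have fin': "icl (ennreal s) \<noteq> \<infinity>" if "s \<le> t" for s
    using icl_eq_top_mono[of "ennreal s" "ennreal t"] fin that by (auto intro: ennreal_leI)
  have bdd: "bdd_above (tr ` {0..<t})"
    by (rule bdd_aboveI2[where M="tr t"]) (auto intro!: tr_mono fin)
  have le_b: "tr s \<le> b" if "0 \<le> s" "s < t" for s
    unfolding b_def using that by (intro cSUP_upper bdd) auto
  have less_b: "tr s < b" if "0 \<le> s" "s < t" for s
  proof -
    obtain r where r: "s < r" "r < t" using dense[OF \<open>s < t\<close>] by auto
    then have "tr s < tr r" using that by (intro tr_strict_mono fin') auto
    with le_b[of r] r that show ?thesis by linarith
  qed
  have near: "eventually (\<lambda>s. a < tr s \<and> tr s < b) (at_left t)" if a: "a < b" for a
  proof -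
    obtain s0 where s0: "0 \<le> s0" "s0 < t" "a < tr s0"
      using a t unfolding b_def less_cSUP_iff[OF _ bdd] by (subst (asm) less_cSUP_iff[OF _ bdd]) auto
    show ?thesis unfolding eventually_at_left_field
      using s0 less_b tr_mono[OF s0(1) _ fin'] by (intro exI[of _ s0]) (auto intro: less_le_trans)
  qed
  have "filterlim tr (at_left b) (at_left t)"
  proof (rule filterlim_at_withinI)
    show "(tr \<longlongrightarrow> b) (at_left t)"
    proof (rule tendstoI)
      fix e :: real assume "0 < e"
      with near[of "b - e"] show "eventually (\<lambda>s. dist (tr s) b < e) (at_left t)"
        by (auto elim!: eventually_mono simp: dist_real_def)
    qed
    show "eventually (\<lambda>s. tr s \<in> {..<b} - {b}) (at_left t)"
      using near[of "b - 1"] by (auto elim: eventually_mono)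
  qed
  moreover have "0 < b" using less_b[of 0] t tr_nonneg[of 0] by linarith
  ultimately show ?thesis by (rule that[rotated])
qed

section \<open>The measure of the clock and the change of variables\<close>

lemma stieltjes_mono: "x \<le> y \<Longrightarrow> l (max 0 x) \<le> l (max 0 y)"
  by (intro l_mono) auto

lemma continuous_stieltjes: "continuous (at x) (\<lambda>s. l (max 0 s))"
proof -
  have "1-lipschitz_on UNIV (\<lambda>s. l (max 0 s))"
  proof (rule lipschitz_onI)
    fix x y :: real
    have *: "\<bar>l (max 0 x) - l (max 0 y)\<bar> \<le> \<bar>x - y\<bar>" if "x \<le> y" for x y
      using l_Lipschitz[of "max 0 x" "max 0 y"] stieltjes_mono[OF that] that
      by (auto simp: max_def split: if_splits)
    show "dist (l (max 0 x)) (l (max 0 y)) \<le> 1 * dist x y"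
      using *[of x y] *[of y x] by (cases "x \<le> y") (auto simp: dist_real_def abs_minus_commute)
  qed simp
  then show ?thesis
    by (meson UNIV_I continuous_on_eq_continuous_at lipschitz_on_continuous_on open_UNIV)
qed

lemma sets_stieltjes [measurable_cong]: "sets (stieltjes l) = sets borel"
  by (simp add: stieltjes_def)

lemma space_stieltjes: "space (stieltjes l) = UNIV"
  by (simp add: stieltjes_def)

lemma emeasure_stieltjes_Ioc:
  "0 \<le> a \<Longrightarrow> a \<le> b \<Longrightarrow> emeasure (stieltjes l) {a<..b} = ennreal (l b - l a)"
  unfolding stieltjes_def
  by (subst emeasure_interval_measure_Ioc)
    (auto intro: stieltjes_mono continuous_stieltjes continuous_at_imp_continuous_at_within)

lemma emeasure_stieltjes_Icc:
  assumes "0 \<le> b" shows "emeasure (stieltjes l) {0..b} = ennreal (l b)"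
  unfolding stieltjes_def using assms
  by (subst emeasure_interval_measure_Icc)
    (auto intro: stieltjes_mono continuous_stieltjes continuous_at_imp_continuous_on simp: l_0)

lemma stieltjes_integral_increment:
  assumes "0 \<le> s" "s \<le> t" and h: "set_borel_measurable borel {0..t} h"
    and K: "\<And>r. 0 \<le> r \<Longrightarrow> \<bar>h r\<bar> \<le> K"
  shows "\<bar>(LINT r:{0..t}|stieltjes l. h r) - (LINT r:{0..s}|stieltjes l. h r)\<bar> \<le> K * (l t - l s)"
proof -
  have "\<bar>(LINT r:{0..t}|stieltjes l. h r) - (LINT r:{0..s}|stieltjes l. h r)\<bar>
      \<le> K * measure (stieltjes l) ({0..t} - {0..s})"
    by (rule set_integral_increment_bound)
      (use assms in \<open>auto simp: sets_stieltjes emeasure_stieltjes_Icc set_borel_measurable_def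
         cong: measurable_cong_sets\<close>)
  also have "{0..t} - {0..s} = {s<..t}" using assms by auto
  also have "measure (stieltjes l) {s<..t} = l t - l s"
    using emeasure_stieltjes_Ioc[OF assms(1,2)] l_mono[OF assms(1,2)] by (simp add: measure_def)
  finally show ?thesis .
qed

text \<open>The two image measures are compared on half-lines. For x \<ge> 0 the s in [0,t] with x <
  tr s fill the interval from l x to t up to the endpoint l x, because l (tr s) = s. Its length t -
  l x, or 0 if this is negative, is also the \<open>stieltjes\<close> mass of (x, tr t].\<close>

lemma stieltjes_change_of_variables:
  assumes t: "0 \<le> t" and fin: "icl (ennreal t) \<noteq> \<infinity>"
    and h: "h \<in> borel_measurable borel"
  shows "(LINT s:{0..t}|lborel. h (tr s)) = (LINT r:{0..tr t}|stieltjes l. (h r :: real))"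
proof -
  define b where "b = tr t"
  have b: "0 \<le> b" "l b = t" using l_tr[OF t fin] by (auto simp: b_def tr_nonneg)
  \<comment> \<open>After \<open>t\<close> the inverse \<open>icl\<close> may become infinite and
    \<open>tr\<close> fall back to 0. Clamping the argument makes the map monotone on the whole
    line, hence Borel.\<close>
  define tr' where "tr' s = tr (max 0 (min s t))" for s
  have fin': "icl (ennreal s) \<noteq> \<infinity>" if "s \<le> t" for s
    using icl_eq_top_mono[of "ennreal s" "ennreal t"] fin that by (auto intro: ennreal_leI)
  have mono_tr': "mono tr'"
    unfolding tr'_def using t by (intro monoI tr_mono fin') auto
  then have [measurable]: "tr' \<in> borel_measurable borel" by (rule borel_measurable_mono)
  have tr'_sets: "tr' -` {x<..} \<in> sets borel" for x
    using measurable_sets[of tr' borel borel "{x<..}"] by simp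
  define N1 where "N1 = distr (density lborel (\<lambda>s. ennreal (indicat_real {0..t} s))) borel tr'"
  define N2 where "N2 = density (stieltjes l) (\<lambda>r. ennreal (indicat_real {0..b} r))"
  have N1: "emeasure N1 {x<..} = emeasure lborel ({0..t} \<inter> {s. x < tr s})" for x
  proof -
    have "emeasure N1 {x<..} = (\<integral>\<^sup>+s. indicator {0..t} s * indicator (tr' -` {x<..}) s \<partial>lborel)"
      unfolding N1_def
      by (subst emeasure_distr, simp, simp, subst emeasure_density)
        (auto simp: ennreal_indicator tr'_sets)
    also have "\<dots> = (\<integral>\<^sup>+s. indicator ({0..t} \<inter> tr' -` {x<..}) s \<partial>lborel)"
      by (simp add: indicator_inter_arith)
    also have "\<dots> = emeasure lborel ({0..t} \<inter> tr' -` {x<..})"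
      by (rule nn_integral_indicator) (auto simp: tr'_sets)
    also have "{0..t} \<inter> tr' -` {x<..} = {0..t} \<inter> {s. x < tr s}"
      by (auto simp: tr'_def)
    finally show ?thesis .
  qed
  have N2: "emeasure N2 {x<..} = emeasure (stieltjes l) ({0..b} \<inter> {x<..})" for x
    unfolding N2_def
    by (subst emeasure_density)
      (auto simp: ennreal_indicator sets_stieltjes indicator_inter_arith[symmetric] nn_integral_indicator
         cong: measurable_cong_sets)
  \<comment> \<open>\<open>ennreal\<close> turns a negative difference into 0, so the formula also
    covers \<open>x\<close> beyond \<open>b\<close>; \<open>max 0 x\<close> covers negative
    \<open>x\<close>, where the whole mass \<open>t\<close> is counted.\<close>
  have eq: "emeasure N1 {x<..} = ennreal (t - l (max 0 x)) \<and> emeasure N2 {x<..} = ennreal (t - l (max 0 x))" for x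
  proof (cases "x < 0")
    case True
    then have "{0..t} \<inter> {s. x < tr s} = {0..t}" "{0..b} \<inter> {x<..} = {0..b}"
      using tr_nonneg by (auto intro: less_le_trans)
    then show ?thesis using True t b by (simp add: N1 N2 emeasure_stieltjes_Icc l_0)
  next
    case False
    then have x: "0 \<le> x" by simp
    have A1: "{l x<..t} \<subseteq> {0..t} \<inter> {s. x < tr s}"
    proof safe
      fix s assume s: "s \<in> {l x<..t}"
      with l_nonneg[OF x] show s0: "s \<in> {0..t}" by auto
      have "l (tr s) = s" using s0 by (intro l_tr fin') auto
      with s have "l x < l (tr s)" by auto
      with l_mono[of "tr s" x] tr_nonneg[of s] show "x < tr s" by (meson not_le)
    qed
    have A2: "{0..t} \<inter> {s. x < tr s} \<subseteq> {l x..t}"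
    proof safe
      fix s assume s: "s \<in> {0..t}" "x < tr s"
      have "l (tr s) = s" using s by (intro l_tr fin') auto
      with l_mono[of x "tr s"] s x show "s \<in> {l x..t}" by auto
    qed
    have S: "{0..t} \<inter> {s. x < tr s} \<in> sets lborel"
    proof -
      have "{0..t} \<inter> {s. x < tr s} = {0..t} \<inter> tr' -` {x<..}" by (auto simp: tr'_def)
      then show ?thesis by (auto simp: tr'_sets)
    qed
    have "emeasure lborel {l x<..t} \<le> emeasure lborel ({0..t} \<inter> {s. x < tr s})"
      by (rule emeasure_mono[OF A1 S])
    moreover have "emeasure lborel ({0..t} \<inter> {s. x < tr s}) \<le> emeasure lborel {l x..t}"
      by (rule emeasure_mono[OF A2]) simp
    ultimately have "emeasure N1 {x<..} = ennreal (t - l x)"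
      unfolding N1 by (cases "l x \<le> t") (auto simp: ennreal_neg)
    moreover have "emeasure N2 {x<..} = ennreal (t - l x)"
    proof (cases "x \<le> b")
      case True
      have "{0..b} \<inter> {x<..} = {x<..b}" using x by auto
      then show ?thesis using emeasure_stieltjes_Ioc[OF x True] b by (simp add: N2)
    next
      case False
      then have "{0..b} \<inter> {x<..} = {}" by auto
      moreover have "t \<le> l x" using False l_mono[of b x] b by auto
      ultimately show ?thesis by (simp add: N2 ennreal_neg)
    qed
    ultimately show ?thesis using x by (simp add: max_def)
  qed
  have "N1 = N2"
  proof (rule measure_eqI_lessThan)
    show "sets N1 = sets borel" "sets N2 = sets borel"
      by (simp_all add: N1_def N2_def sets_stieltjes)
  qed (auto simp: eq)
  then have "integral\<^sup>L N1 h = integral\<^sup>L N2 h" by simp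
  moreover have "integral\<^sup>L N1 h = (LINT s:{0..t}|lborel. h (tr s))"
  proof -
    have "integral\<^sup>L N1 h = (LINT s|lborel. indicat_real {0..t} s *\<^sub>R h (tr' s))"
      unfolding N1_def using h
      by (subst integral_distr, simp, simp, intro integral_density) auto
    also have "\<dots> = (LINT s:{0..t}|lborel. h (tr s))"
      unfolding set_lebesgue_integral_def
      by (intro Bochner_Integration.integral_cong) (auto simp: indicator_def tr'_def)
    finally show ?thesis .
  qed
  moreover have "integral\<^sup>L N2 h = (LINT r:{0..b}|stieltjes l. h r)"
    unfolding N2_def set_lebesgue_integral_def using h
    by (intro integral_density) (auto simp: sets_stieltjes cong: measurable_cong_sets)
  ultimately show ?thesis by (simp add: b_def)
qed

lemma time_change_in_closed:
  assumes t: "0 \<le> t" and fin: "icl (ennreal t) \<noteq> \<infinity>" and S: "closed S"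
    and w: "\<And>r. 0 \<le> r \<Longrightarrow> (w \<longlongrightarrow> w r) (at_right r)"
    and AE: "AE r in stieltjes l. 0 \<le> r \<longrightarrow> w r \<in> S"
  shows "w (tr t) \<in> S"
proof -
  have "frequently (\<lambda>r. w r \<in> S) (at_right (tr t))"
  proof (rule ccontr)
    assume "\<not> frequently (\<lambda>r. w r \<in> S) (at_right (tr t))"
    then have "eventually (\<lambda>r. w r \<notin> S) (at_right (tr t))" by (simp add: not_frequently)
    then obtain c where c: "tr t < c" "\<And>r. tr t < r \<Longrightarrow> r < c \<Longrightarrow> w r \<notin> S"
      unfolding eventually_at_right_field by blast
    define d where "d = (tr t + c) / 2"
    have d: "tr t < d" "d < c" using c(1) by (auto simp: d_def)
    have d0: "0 \<le> d" using d tr_nonneg[of t] by linarith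
    have "icl (ennreal t) < ennreal d" using d d0 by (simp add: icl_tr[OF fin] ennreal_less_iff tr_nonneg)
    then have "t < l d" using t d0 by (subst (asm) icl_less_iff) (auto simp: ennreal_less_iff)
    then have pos: "0 < emeasure (stieltjes l) {tr t<..d}"
      using emeasure_stieltjes_Ioc[of "tr t" d] d tr_nonneg[of t] l_tr[OF t fin] by simp
    have "AE r in stieltjes l. r \<notin> {tr t<..d}"
      using AE
    proof eventually_elim
      fix r assume "0 \<le> r \<longrightarrow> w r \<in> S"
      with c(2)[of r] d tr_nonneg[of t] show "r \<notin> {tr t<..d}" by auto
    qed
    then have "emeasure (stieltjes l) {tr t<..d} = 0"
      by (subst (asm) AE_iff_measurable[where N="{tr t<..d}"]) (auto simp: sets_stieltjes space_stieltjes)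
    with pos show False by simp
  qed
  then show ?thesis
    using topological_tendstoD[OF w[OF tr_nonneg] open_Compl[OF S], of t]
    by (auto simp: frequently_def)
qed

end

section \<open>Integrals against the random measure\<close>

text \<open>Ceilings produce cells ((k-1)/m, k/m], whose mass is a difference of evaluations of the
  random measure on intervals [0,s]. At a grid point the sampling time is \<open>r\<close> itself
  instead of a later time, so the limit along \<open>at_right\<close> does not apply directly and
  the two cases are separated.\<close>

lemma tendsto_min_grid_ceiling:
  fixes w :: "real \<Rightarrow> 'b::topological_space"
  assumes "r \<le> t" and rc: "r < t \<Longrightarrow> (w \<longlongrightarrow> w r) (at_right r)"
  shows "(\<lambda>n. w (min t (real_of_int \<lceil>real (Suc n) * r\<rceil> / real (Suc n)))) \<longlonglongrightarrow> w r"
proof (cases "r = t")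
  case True
  have "r \<le> real_of_int \<lceil>real (Suc n) * r\<rceil> / real (Suc n)" for n
    using le_of_int_ceiling[of "real (Suc n) * r"] by (simp add: pos_le_divide_eq mult.commute)
  then have "min t (real_of_int \<lceil>real (Suc n) * r\<rceil> / real (Suc n)) = r" for n
    using True by (simp add: min_def antisym)
  then show ?thesis by simp
next
  case False
  with assms(1) have "r < t" by simp
  show ?thesis
  proof (rule topological_tendstoI)
    fix O' assume O': "open O'" "w r \<in> O'"
    obtain b where b: "r < b" "\<And>y. r < y \<Longrightarrow> y < b \<Longrightarrow> w y \<in> O'"
      using topological_tendstoD[OF rc[OF \<open>r < t\<close>] O'] unfolding eventually_at_right_field by blast
    have "(\<lambda>n. grid_above n r) \<longlonglongrightarrow> r"
      using grid_above_at_right filterlim_at by blast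
    then have "eventually (\<lambda>n. grid_above n r < b) sequentially"
      using \<open>r < b\<close> by (rule order_tendstoD)
    then show "eventually (\<lambda>n. w (min t (real_of_int \<lceil>real (Suc n) * r\<rceil> / real (Suc n))) \<in> O') sequentially"
    proof eventually_elim
      fix n assume n: "grid_above n r < b"
      let ?y = "real_of_int \<lceil>real (Suc n) * r\<rceil> / real (Suc n)"
      have ry: "r \<le> ?y"
        using le_of_int_ceiling[of "real (Suc n) * r"] by (simp add: pos_le_divide_eq mult.commute)
      have "real_of_int \<lceil>real (Suc n) * r\<rceil> \<le> real_of_int \<lfloor>real (Suc n) * r\<rfloor> + 1"
        using ceiling_diff_floor_le_1[of "real (Suc n) * r"] by linarith
      then have "?y \<le> grid_above n r"
        unfolding grid_above_def by (intro divide_right_mono) auto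
      with n have "?y < b" by simp
      with ry \<open>r < t\<close> show "w (min t ?y) \<in> O'"
        using O'(2) by (cases "min t ?y = r") (auto intro!: b(2))
    qed
  qed
qed

text \<open>Each point is sent to the first member, in a fixed enumeration, of a finite net that is
  within distance \<open>e\<close>; choosing the least index makes the map Borel.\<close>

lemma compact_finite_valued_projection:
  assumes "compact (UNIV :: 'u::metric_space set)" and e: "0 < e"
  obtains p :: "'u::metric_space \<Rightarrow> 'u" and V where "finite V" "\<And>u. p u \<in> V" "\<And>v. p -` {v} \<in> sets borel"
    "\<And>u. dist (p u) u < e"
proof -
  obtain K :: "'u set" where K: "finite K" "UNIV \<subseteq> (\<Union>x\<in>K. ball x e)"
    using assms unfolding compact_eq_totally_bounded by blast
  obtain xs where xs: "set xs = K" using finite_list[OF K(1)] by blast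
  define P where "P i u \<longleftrightarrow> i < length xs \<and> dist (xs ! i) u < e" for i u
  have ex: "\<exists>i. P i u" for u
  proof -
    obtain x where "x \<in> K" "dist x u < e" using K(2) by force
    then show ?thesis using xs by (auto simp: P_def in_set_conv_nth)
  qed
  define p where "p u = xs ! (LEAST i. P i u)" for u
  have P: "P (LEAST i. P i u) u" for u using ex by (rule LeastI_ex)
  have meas: "Measurable.pred borel (P i)" for i
  proof -
    have "{u. P i u} = (if i < length xs then ball (xs ! i) e else {})" by (auto simp: P_def)
    then show ?thesis by (simp add: Measurable.pred_def)
  qed
  have "(\<lambda>u. LEAST i. P i u) \<in> borel \<rightarrow>\<^sub>M count_space UNIV"
    by (rule measurable_Least) (rule meas)
  then have "p \<in> borel \<rightarrow>\<^sub>M count_space UNIV"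
    unfolding p_def[abs_def] by (rule measurable_compose) simp
  then have "p -` {v} \<in> sets borel" for v
    using measurable_sets[of p borel "count_space UNIV" "{v}"] by simp
  moreover have "p u \<in> K" "dist (p u) u < e" for u
    using P[of u] xs by (auto simp: P_def p_def)
  ultimately show ?thesis using that[of K p] K(1) by blast
qed

text \<open>Metric spaces are normal, so Tietze applies. The extension is taken of
  \<open>op_val B f\<close>, which has to be evaluated at sampled positions that need not lie in
  \<open>\<Xi>\<close>.\<close>

lemma continuous_extension_from_closed:
  fixes h :: "'a::metric_space \<Rightarrow> real"
  assumes "closed S" "continuous_on S h"
  obtains g :: "'a \<Rightarrow> real" where "continuous_on UNIV g" "\<And>x. x \<in> S \<Longrightarrow> g x = h x"
proof -
  have "normal_space (euclidean :: 'a topology)"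
    by (simp add: metrizable_imp_normal_space metrizable_space_euclidean)
  then show ?thesis
    using that assms unfolding normal_space_iff_Tietze
    by (metis closed_closedin continuous_map_iff_continuous continuous_map_iff_continuous2)
qed

lemma compact_UNIV_bounded:
  fixes g :: "'a::topological_space \<Rightarrow> real"
  assumes "compact (UNIV :: 'a set)" "continuous_on UNIV g"
  obtains K where "0 \<le> K" "\<And>x. \<bar>g x\<bar> \<le> K"
proof -
  have "bounded (range g)" by (rule compact_imp_bounded[OF compact_continuous_image[OF assms(2,1)]])
  then obtain K where K: "\<And>x. \<bar>g x\<bar> \<le> K" unfolding bounded_iff by auto
  moreover have "0 \<le> K" using K[of undefined] by linarith
  ultimately show ?thesis by (rule that[rotated])
qed

locale compact_controlled_solution =
  controlled_martingale_solution M F A E0 B \<Xi> Y l0 L1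
  for M :: "'w measure" and F :: "ennreal \<Rightarrow> 'w measure"
    and A :: "(('e::metric_space \<Rightarrow>\<^sub>C real) \<times> ('e \<Rightarrow>\<^sub>C real)) set"
    and E0 :: "'e set"
    and B :: "(('e \<Rightarrow>\<^sub>C real) \<times> ('e \<times> 'u::metric_space \<Rightarrow> real)) set"
    and \<Xi> :: "('e \<times> 'u) set"
    and Y :: "real \<Rightarrow> 'w \<Rightarrow> 'e"
    and l0 :: "real \<Rightarrow> 'w \<Rightarrow> real"
    and L1 :: "'w \<Rightarrow> (real \<times> 'u) measure" +
  assumes compact_E: "compact (UNIV :: 'e set)" and compact_U: "compact (UNIV :: 'u set)"
    and closed_\<Xi>: "closed \<Xi>"
    and single_valued_B: "single_valued B" and Range_B: "Range B \<subseteq> cont_funs \<Xi>"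
    and right_continuous_F: "right_continuous_filtration F"
begin

sublocale filtered_prob_space M F
  by unfold_locales (rule subalg)

section \<open>The clock and the measurability of position and control\<close>

lemma l0_0: "\<omega> \<in> space M \<Longrightarrow> l0 0 \<omega> = 0"
  using clock[of \<omega> 0] l0_nonneg[of \<omega> 0] measure_nonneg[of "L1 \<omega>" "{0..0} \<times> UNIV"] by linarith

lemma sets_L1: "\<omega> \<in> space M \<Longrightarrow> sets (L1 \<omega>) = sets (restrict_space borel ({0..} \<times> UNIV))"
  using L1_space by (auto simp: L_space_def)

lemma halfspace_borel: "{0::real..} \<times> (UNIV :: 'u set) \<in> sets borel"
  by (intro borel_closed closed_Times) auto

lemma space_L1: "\<omega> \<in> space M \<Longrightarrow> space (L1 \<omega>) = {0..} \<times> UNIV"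
  using sets_eq_imp_space_eq[OF sets_L1] halfspace_borel by simp

lemma sets_L1_iff: "\<omega> \<in> space M \<Longrightarrow> S \<in> sets (L1 \<omega>) \<longleftrightarrow> S \<subseteq> {0..} \<times> UNIV \<and> S \<in> sets borel"
  by (simp add: sets_L1 sets_restrict_space_iff halfspace_borel)

lemma Times_sets_L1:
  "\<omega> \<in> space M \<Longrightarrow> S \<subseteq> {0..} \<Longrightarrow> S \<in> sets borel \<Longrightarrow> C \<in> sets borel \<Longrightarrow> S \<times> C \<in> sets (L1 \<omega>)"
  by (auto simp: sets_L1_iff intro: borel_Times)

lemma measurable_L1: "\<omega> \<in> space M \<Longrightarrow> f \<in> borel \<rightarrow>\<^sub>M N \<Longrightarrow> f \<in> L1 \<omega> \<rightarrow>\<^sub>M N"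
  using measurable_restrict_space1 by (subst measurable_cong_sets[OF sets_L1 refl]) auto

lemma emeasure_L1_finite:
  assumes "\<omega> \<in> space M" "0 \<le> t" shows "emeasure (L1 \<omega>) ({0..t} \<times> C) < \<infinity>"
proof -
  have "emeasure (L1 \<omega>) ({0..t} \<times> C) \<le> emeasure (L1 \<omega>) ({0..t} \<times> UNIV)"
    using assms by (intro emeasure_mono Times_sets_L1) auto
  also have "\<dots> < \<infinity>" using L1_space[OF assms(1)] assms(2) by (auto simp: L_space_def)
  finally show ?thesis .
qed

lemma measure_L1: "\<omega> \<in> space M \<Longrightarrow> 0 \<le> t \<Longrightarrow> measure (L1 \<omega>) ({0..t} \<times> UNIV) = t - l0 t \<omega>"
  using clock[of \<omega> t] by linarith

lemma measure_L1_diff: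
  assumes "\<omega> \<in> space M" "0 \<le> s" "s \<le> t" and C: "C \<in> sets borel"
  shows "measure (L1 \<omega>) ({s<..t} \<times> C) = measure (L1 \<omega>) ({0..t} \<times> C) - measure (L1 \<omega>) ({0..s} \<times> C)"
proof -
  have "{s<..t} \<times> C = {0..t} \<times> C - {0..s} \<times> C" using assms by auto
  then show ?thesis
    using assms emeasure_L1_finite[of \<omega> t C] by (auto simp: Times_sets_L1 intro!: measure_Diff)
qed

text \<open>The slope is at most 1 because the complementary part of the clock, the mass of
  \<open>L1\<close> up to time t, is nondecreasing as well.\<close>

lemma clock_path: assumes \<omega>: "\<omega> \<in> space M" shows "clock_path (\<lambda>t. l0 t \<omega>)"
proof
  show "l0 0 \<omega> = 0" by (rule l0_0[OF \<omega>])
  fix s t :: real assume st: "0 \<le> s" "s \<le> t"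
  then show "l0 s \<omega> \<le> l0 t \<omega>" using mono_onD[OF l0_mono[OF \<omega>], of s t] by auto
  have "measure (L1 \<omega>) ({s<..t} \<times> UNIV) = (t - l0 t \<omega>) - (s - l0 s \<omega>)"
    using measure_L1_diff[OF \<omega> st, of UNIV] measure_L1[OF \<omega>] st by simp
  then show "l0 t \<omega> - l0 s \<omega> \<le> t - s"
    using measure_nonneg[of "L1 \<omega>" "{s<..t} \<times> UNIV"] by linarith
qed

lemma Y_right_continuous: "\<omega> \<in> space M \<Longrightarrow> 0 \<le> t \<Longrightarrow> ((\<lambda>t. Y t \<omega>) \<longlongrightarrow> Y t \<omega>) (at_right t)"
  using Y_paths[of \<omega>] by (auto simp: skorohod_paths_def)

text \<open>The pair is treated as a single process in the product space, continuous in z for fixed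
  time and right continuous in time for fixed z. The composition lemma then gives measurability for
  the Borel sets of the product directly.\<close>

lemma position_measurable:
  assumes \<omega>: "\<omega> \<in> space M"
  shows "(\<lambda>z. (Y (fst z) \<omega>, snd z)) \<in> L1 \<omega> \<rightarrow>\<^sub>M borel"
proof (rule measurable_compose_right_continuous_unbounded[where W="\<lambda>s z. (Y s \<omega>, snd z)"])
  show "fst \<in> borel_measurable (L1 \<omega>)"
    by (intro measurable_L1[OF \<omega>] borel_measurable_continuous_onI continuous_intros)
  show "(\<lambda>z. (Y s \<omega>, snd z)) \<in> L1 \<omega> \<rightarrow>\<^sub>M borel" for s
    by (intro measurable_L1[OF \<omega>] borel_measurable_continuous_onI continuous_intros)
  show "((\<lambda>s. (Y s \<omega>, snd z)) \<longlongrightarrow> (Y s \<omega>, snd z)) (at_right s)" if "0 \<le> s" for s z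
    by (intro tendsto_intros Y_right_continuous[OF \<omega> that])
qed (auto simp: space_L1[OF \<omega>])

text \<open>On [0,n] the total mass is finite and equals the mass of the part in
  \<open>\<Xi>\<close>, so the rest is null; countably many \<open>n\<close> exhaust the
  half-line.\<close>

lemma AE_L1_carrier:
  assumes \<omega>: "\<omega> \<in> space M"
  shows "AE z in L1 \<omega>. (Y (fst z) \<omega>, snd z) \<in> \<Xi>"
proof -
  have \<Xi>: "\<Xi> \<in> sets borel" using closed_\<Xi> by simp
  define Q where "Q = {z \<in> space (L1 \<omega>). (Y (fst z) \<omega>, snd z) \<in> \<Xi>}"
  have Q: "Q \<in> sets (L1 \<omega>)"
    using measurable_sets[OF position_measurable[OF \<omega>] \<Xi>] by (auto simp: Q_def vimage_def Int_def conj_commute)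
  have "AE z in L1 \<omega>. z \<in> {0..real n} \<times> UNIV \<longrightarrow> z \<in> Q" for n
  proof -
    let ?S = "{0..real n} \<times> (UNIV :: 'u set)"
    have S: "?S \<in> sets (L1 \<omega>)" by (rule Times_sets_L1[OF \<omega>]) auto
    have "emeasure (L1 \<omega>) ?S = (\<integral>\<^sup>+z. indicator (?S \<inter> Q) z \<partial>L1 \<omega>)"
      unfolding L1_carrier[OF \<omega> of_nat_0_le_iff]
      by (intro nn_integral_cong) (auto simp: indicator_def Q_def)
    also have "\<dots> = emeasure (L1 \<omega>) (?S \<inter> Q)" using S Q by simp
    finally have "emeasure (L1 \<omega>) (?S - (?S \<inter> Q)) = 0"
      using S Q emeasure_L1_finite[OF \<omega>, of "real n" UNIV] by (subst emeasure_Diff) auto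
    then have "AE z in L1 \<omega>. z \<notin> ?S - (?S \<inter> Q)"
      using S Q by (intro AE_not_in) (auto simp: null_sets_def)
    then show ?thesis by eventually_elim auto
  qed
  then have "AE z in L1 \<omega>. \<forall>n::nat. z \<in> {0..real n} \<times> UNIV \<longrightarrow> z \<in> Q"
    by (subst AE_all_countable) auto
  then show ?thesis
  proof (rule AE_mp, intro AE_I2 impI)
    fix z assume z: "z \<in> space (L1 \<omega>)" and *: "\<forall>n::nat. z \<in> {0..real n} \<times> UNIV \<longrightarrow> z \<in> Q"
    obtain n :: nat where "fst z \<le> real n" using real_arch_simple by blast
    with z * have "z \<in> Q" by (auto simp: space_L1[OF \<omega>])
    then show "(Y (fst z) \<omega>, snd z) \<in> \<Xi>" by (simp add: Q_def)
  qed
qed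

text \<open>The time set is an argument because [0,t], [0,\<infinity>) and the random interval up to
  \<open>\<tau>\<close> all occur. The integrand lives on the whole product, so that it can be the
  extension of \<open>op_val B f\<close>.\<close>

definition control_integral :: "('e \<times> 'u \<Rightarrow> real) \<Rightarrow> real set \<Rightarrow> 'w \<Rightarrow> real" where
  "control_integral g S \<omega> = (LINT z:S \<times> UNIV|L1 \<omega>. g (Y (fst z) \<omega>, snd z))"

lemma integrand_measurable:
  "\<omega> \<in> space M \<Longrightarrow> g \<in> borel_measurable borel \<Longrightarrow> (\<lambda>z. g (Y (fst z) \<omega>, snd z)) \<in> borel_measurable (L1 \<omega>)"
  using measurable_compose[OF position_measurable] by blast

lemma control_integral_increment:
  assumes \<omega>: "\<omega> \<in> space M" and st: "0 \<le> s" "s \<le> t" and g: "g \<in> borel_measurable borel" and K: "\<And>x. \<bar>g x\<bar> \<le> K"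
  shows "\<bar>control_integral g {0..t} \<omega> - control_integral g {0..s} \<omega>\<bar> \<le> K * (t - l0 t \<omega> - (s - l0 s \<omega>))"
proof -
  have "\<bar>control_integral g {0..t} \<omega> - control_integral g {0..s} \<omega>\<bar>
      \<le> K * measure (L1 \<omega>) ({0..t} \<times> UNIV - {0..s} \<times> UNIV)"
    unfolding control_integral_def
    by (rule set_integral_increment_bound)
      (use assms integrand_measurable[OF \<omega> g] emeasure_L1_finite[OF \<omega>, of t UNIV] in
        \<open>auto simp: Times_sets_L1 set_borel_measurable_def
           intro!: borel_measurable_times borel_measurable_indicator\<close>)
  also have "{0..t} \<times> UNIV - {0..s} \<times> UNIV = {s<..t} \<times> UNIV" using st by auto
  finally show ?thesis using measure_L1_diff[OF \<omega> st, of UNIV] measure_L1[OF \<omega>] st by simp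
qed

lemma control_integral_right_continuous:
  assumes \<omega>: "\<omega> \<in> space M" and s: "0 \<le> s" and g: "g \<in> borel_measurable borel" and K: "\<And>x. \<bar>g x\<bar> \<le> K"
  shows "((\<lambda>t. control_integral g {0..t} \<omega>) \<longlongrightarrow> control_integral g {0..s} \<omega>) (at_right s)"
proof (rule tendsto_at_right_Lipschitz[where K=K])
  fix t assume st: "s \<le> t"
  have K0: "0 \<le> K" using K[of undefined] by linarith
  have "t - l0 t \<omega> - (s - l0 s \<omega>) \<le> t - s"
    using clock_path.l_mono[OF clock_path[OF \<omega>] s st] by simp
  from mult_left_mono[OF this K0] control_integral_increment[OF \<omega> s st g K]
  show "\<bar>control_integral g {0..t} \<omega> - control_integral g {0..s} \<omega>\<bar> \<le> K * (t - s)" by linarith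
qed

lemma control_integral_bound:
  assumes \<omega>: "\<omega> \<in> space M" and t: "0 \<le> t" and g: "g \<in> borel_measurable borel" and K: "\<And>x. \<bar>g x\<bar> \<le> K"
  shows "\<bar>control_integral g {0..t} \<omega>\<bar> \<le> K * (t - l0 t \<omega>)"
proof -
  have "\<bar>control_integral g {0..t} \<omega> - (LINT z:{}|L1 \<omega>. g (Y (fst z) \<omega>, snd z))\<bar>
      \<le> K * measure (L1 \<omega>) ({0..t} \<times> UNIV - {})"
    unfolding control_integral_def
    by (rule set_integral_increment_bound)
      (use assms integrand_measurable[OF \<omega> g] emeasure_L1_finite[OF \<omega>, of t UNIV] in
        \<open>auto simp: Times_sets_L1 set_borel_measurable_def
           intro!: borel_measurable_times borel_measurable_indicator\<close>)
  then show ?thesis by (simp add: measure_L1[OF \<omega> t] set_lebesgue_integral_def[of _ "{}"])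
qed

lemma measure_L1_adapted:
  assumes "0 \<le> s" "s \<le> t" "C \<in> sets borel"
  shows "(\<lambda>\<omega>. measure (L1 \<omega>) ({0..s} \<times> C)) \<in> borel_measurable (F (ennreal t))"
  unfolding measure_def
  by (intro borel_measurable_enn2real measurable_mono[OF L1_adapted[OF assms(1,3)] ennreal_leI[OF assms(2)]])

text \<open>The integral is approximated by replacing the time by the next point of a grid and the control
  by a point of a finite net, which leaves a finite sum of evaluations of the random measure.\<close>

lemma control_integral_adapted:
  assumes g: "continuous_on UNIV g" and t: "0 \<le> t"
  shows "control_integral g {0..t} \<in> borel_measurable (F (ennreal t))"
proof -
  obtain K where K: "0 \<le> K" "\<And>x. \<bar>g x\<bar> \<le> K"
    using compact_UNIV_bounded[OF _ g] compact_Times[OF compact_E compact_U] by auto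
  have "\<forall>n. \<exists>p V. finite V \<and> (\<forall>u. p u \<in> V) \<and> (\<forall>v. p -` {v} \<in> sets borel) \<and> (\<forall>u::'u. dist (p u) u < 1 / real (Suc n))"
  proof
    fix n
    obtain p :: "'u \<Rightarrow> 'u" and V where "finite V" "\<And>u. p u \<in> V" "\<And>v. p -` {v} \<in> sets borel"
        "\<And>u. dist (p u) u < 1 / real (Suc n)"
      by (rule compact_finite_valued_projection[OF compact_U, of "1 / real (Suc n)"]) auto
    then show "\<exists>p V. finite V \<and> (\<forall>u. p u \<in> V) \<and> (\<forall>v. p -` {v} \<in> sets borel) \<and> (\<forall>u::'u. dist (p u) u < 1 / real (Suc n))"
      by blast
  qed
  then obtain p :: "nat \<Rightarrow> 'u \<Rightarrow> 'u" and V where V: "\<And>n. finite (V n)" "\<And>n u. p n u \<in> V n"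
      "\<And>n v. p n -` {v} \<in> sets borel" "\<And>n u. dist (p n u) u < 1 / real (Suc n)"
    by metis
  have p_lim: "(\<lambda>n. p n u) \<longlonglongrightarrow> u" for u
  proof (subst tendsto_dist_iff, rule tendsto_sandwich[where f="\<lambda>_. 0"])
    show "(\<lambda>n. 1 / real (Suc n)) \<longlonglongrightarrow> 0"
      using LIMSEQ_inverse_real_of_nat by (simp add: inverse_eq_divide)
  qed (auto intro!: always_eventually less_imp_le[OF V(4)[simplified]])
  define m where "m n = real (Suc n)" for n
  have m: "0 < m n" for n by (simp add: m_def)
  define I where "I n = {0..\<lceil>m n * t\<rceil>}" for n
  \<comment> \<open>Cutting at \<open>t\<close> keeps the sampled values of \<open>Y\<close>
    measurable for F(t).\<close>
  define q where "q n k = min t (real_of_int k / m n)" for n and k :: int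
  have q: "0 \<le> q n k" "q n k \<le> t" if "k \<in> I n" for n k
    using that t m[of n] by (auto simp: q_def I_def)
  define T where "T n k = {s \<in> {0..t}. \<lceil>m n * s\<rceil> = k}" for n and k :: int
  \<comment> \<open>\<open>a n\<close> is the integrand at sampled time and projected control, and
    \<open>S n\<close> is its integral written as a finite sum: adaptedness is read off the sum,
    convergence off the integral.\<close>
  define a where "a n \<omega> z = g (Y (q n \<lceil>m n * fst z\<rceil>) \<omega>, p n (snd z))" for n \<omega> and z :: "real \<times> 'u"
  define S where "S n \<omega> = (\<Sum>k\<in>I n. \<Sum>v\<in>V n. g (Y (q n k) \<omega>, v) * measure (L1 \<omega>) (T n k \<times> p n -` {v}))" for n \<omega>
  \<comment> \<open>A ceiling equal to 0 at s \<ge> 0 means s = 0, so the cell for k = 0 is one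
    point. All other cells are half-open intervals, whose masses are differences of adapted
    evaluations.\<close>
  have T_alt: "T n k = (if k = 0 then {0..0} else {real_of_int (k - 1) / m n<..q n k})"
    if k: "k \<in> I n" for n k
  proof -
    have k0: "0 \<le> k" using k by (auto simp: I_def)
    have "(s \<in> {0..t} \<and> \<lceil>m n * s\<rceil> = k) = (s \<in> (if k = 0 then {0..0} else {real_of_int (k - 1) / m n<..q n k}))" for s
    proof (cases "k = 0")
      case True
      then show ?thesis using m[of n] t
        by (auto simp: ceiling_eq_iff mult_le_0_iff)
    next
      case False
      with k0 have k1: "1 \<le> k" by simp
      have "0 \<le> s" if "real_of_int k < 1 + s * m n"
      proof -
        have "0 < s * m n" using that k1 by linarith
        then show ?thesis using m[of n] by (simp add: zero_less_mult_iff)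
      qed
      moreover have "(real_of_int (k - 1) / m n < s) = (real_of_int k < 1 + s * m n)"
          "(s \<le> real_of_int k / m n) = (s * m n \<le> real_of_int k)"
        using m[of n] by (auto simp: pos_divide_less_eq pos_le_divide_eq)
      ultimately show ?thesis using False
        by (auto simp: ceiling_eq_iff q_def mult.commute)
    qed
    then show ?thesis unfolding T_def by auto
  qed
  have T_borel: "T n k \<in> sets borel" "T n k \<subseteq> {0..}" if "k \<in> I n" for n k
    by (simp add: T_alt[OF that]) (auto simp: T_def)
  have meas_T: "(\<lambda>\<omega>. measure (L1 \<omega>) (T n k \<times> p n -` {v})) \<in> borel_measurable (F (ennreal t))"
    if k: "k \<in> I n" for n k v
  proof (cases "k = 0")
    case True
    then show ?thesis using measure_L1_adapted[OF _ t V(3)] T_alt[OF k] by simp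
  next
    case False
    then have k1: "1 \<le> k" "real_of_int k - 1 < m n * t" using k by (auto simp: I_def le_ceiling_iff)
    let ?r = "real_of_int (k - 1) / m n"
    have r: "0 \<le> ?r" "?r \<le> q n k" using k1 m[of n] by (auto simp: q_def field_simps)
    have "(\<lambda>\<omega>. measure (L1 \<omega>) ({0..q n k} \<times> p n -` {v}) - measure (L1 \<omega>) ({0..?r} \<times> p n -` {v}))
        \<in> borel_measurable (F (ennreal t))"
      using r q[OF k] by (intro borel_measurable_diff measure_L1_adapted V(3)) auto
    then show ?thesis
      by (rule measurable_cong[THEN iffD1, rotated])
        (use T_alt[OF k] False measure_L1_diff[OF _ r V(3)] in \<open>auto simp: space_F\<close>)
  qed
  have S_meas: "S n \<in> borel_measurable (F (ennreal t))" for n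
    unfolding S_def[abs_def]
  proof (intro borel_measurable_sum borel_measurable_times meas_T)
    fix k v assume k: "k \<in> I n"
    have "(\<lambda>x. g (x, v)) \<in> borel_measurable borel"
      by (intro borel_measurable_continuous_onI continuous_on_compose2[OF g] continuous_intros) auto
    then show "(\<lambda>\<omega>. g (Y (q n k) \<omega>, v)) \<in> borel_measurable (F (ennreal t))"
      using measurable_compose[OF measurable_mono[OF Y_adapted ennreal_leI], OF q[OF k]] by blast
  qed
  show ?thesis
  proof (rule borel_measurable_LIMSEQ_metric[OF S_meas])
    fix \<omega> assume "\<omega> \<in> space (F (ennreal t))"
    then have \<omega>: "\<omega> \<in> space M" by (simp add: space_F)
    let ?D = "{0..t} \<times> (UNIV :: 'u set)"
    have D: "?D \<in> sets (L1 \<omega>)" by (rule Times_sets_L1[OF \<omega>]) auto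
    \<comment> \<open>For \<open>z\<close> in \<open>?D\<close> exactly one pair contributes:
      \<open>k\<close> is the ceiling of its scaled time and \<open>v\<close> its projected
      control.\<close>
    have step: "indicator ?D z * a n \<omega> z =
        (\<Sum>k\<in>I n. \<Sum>v\<in>V n. g (Y (q n k) \<omega>, v) * indicator (T n k \<times> p n -` {v}) z)" for n z
    proof -
      have "(\<Sum>k\<in>I n. \<Sum>v\<in>V n. g (Y (q n k) \<omega>, v) * indicator (T n k \<times> p n -` {v}) z) =
        (\<Sum>k\<in>I n. \<Sum>v\<in>V n. if v = p n (snd z) then (if fst z \<in> T n k then g (Y (q n k) \<omega>, v) else 0) else 0)"
        by (intro sum.cong) (auto simp: indicator_def mem_Times_iff)
      also have "\<dots> = (\<Sum>k\<in>I n. if fst z \<in> T n k then g (Y (q n k) \<omega>, p n (snd z)) else 0)"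
        using V(1,2) by (simp add: sum.delta)
      also have "\<dots> = (\<Sum>k\<in>I n. if k = \<lceil>m n * fst z\<rceil> then indicator ?D z * a n \<omega> z else 0)"
        by (intro sum.cong) (auto simp: T_def a_def indicator_def mem_Times_iff)
      also have "\<dots> = (if \<lceil>m n * fst z\<rceil> \<in> I n then indicator ?D z * a n \<omega> z else 0)"
        by (simp add: I_def sum.delta)
      also have "\<dots> = indicator ?D z * a n \<omega> z"
      proof (cases "z \<in> ?D")
        case True
        then have z: "0 \<le> m n * fst z" "m n * fst z \<le> m n * t"
          using m[of n] by (auto simp: mem_Times_iff)
        from ceiling_mono[OF z(1)] ceiling_mono[OF z(2)] have "\<lceil>m n * fst z\<rceil> \<in> I n"
          by (simp add: I_def)
        then show ?thesis by simp
      qed simp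
      finally show ?thesis by simp
    qed
    have TV: "T n k \<times> p n -` {v} \<in> sets (L1 \<omega>)" if "k \<in> I n" for n k v
      using T_borel[OF that] by (intro Times_sets_L1[OF \<omega>] V(3))
    have TV_fin: "emeasure (L1 \<omega>) (T n k \<times> p n -` {v}) < \<infinity>" for n k v
    proof -
      have "emeasure (L1 \<omega>) (T n k \<times> p n -` {v}) \<le> emeasure (L1 \<omega>) ?D"
        using D by (intro emeasure_mono) (auto simp: T_def)
      then show ?thesis using emeasure_L1_finite[OF \<omega> t, of UNIV] by (rule le_less_trans)
    qed
    have int_TV: "integrable (L1 \<omega>) (\<lambda>z. c * indicat_real (T n k \<times> p n -` {v}) z)" if "k \<in> I n" for n k v c
      using TV[OF that] TV_fin by (intro integrable_mult_right integrable_real_indicator)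
    have S_eq: "S n \<omega> = (LINT z|L1 \<omega>. indicator ?D z * a n \<omega> z)" for n
    proof -
      have "(LINT z|L1 \<omega>. indicator ?D z * a n \<omega> z) =
          (\<Sum>k\<in>I n. (LINT z|L1 \<omega>. (\<Sum>v\<in>V n. g (Y (q n k) \<omega>, v) * indicator (T n k \<times> p n -` {v}) z)))"
        unfolding step
        by (intro Bochner_Integration.integral_sum Bochner_Integration.integrable_sum int_TV)
      also have "\<dots> = (\<Sum>k\<in>I n. \<Sum>v\<in>V n. (LINT z|L1 \<omega>. g (Y (q n k) \<omega>, v) * indicator (T n k \<times> p n -` {v}) z))"
        by (intro sum.cong refl Bochner_Integration.integral_sum int_TV)
      also have "\<dots> = S n \<omega>"
        unfolding S_def
        by (intro sum.cong refl) (simp add: Int_absorb2 TV[THEN sets.sets_into_space])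
      finally show ?thesis by simp
    qed
    show "(\<lambda>n. S n \<omega>) \<longlonglongrightarrow> control_integral g {0..t} \<omega>"
      unfolding S_eq control_integral_def set_lebesgue_integral_def real_scaleR_def
    proof (rule integral_dominated_convergence[where w="\<lambda>z. indicat_real ?D z * K"])
      have g_borel: "g \<in> borel_measurable borel" by (rule borel_measurable_continuous_onI[OF g])
      show "(\<lambda>z. indicat_real ?D z * g (Y (fst z) \<omega>, snd z)) \<in> borel_measurable (L1 \<omega>)"
        using D integrand_measurable[OF \<omega> g_borel] by (intro borel_measurable_times) auto
      show "(\<lambda>z. indicat_real ?D z * a n \<omega> z) \<in> borel_measurable (L1 \<omega>)" for n
        unfolding step using TV by (intro borel_measurable_sum borel_measurable_times) auto
      show "integrable (L1 \<omega>) (\<lambda>z. indicat_real ?D z * K)"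
        using D emeasure_L1_finite[OF \<omega> t, of UNIV] by (intro integrable_mult_left integrable_real_indicator) auto
      show "AE z in L1 \<omega>. norm (indicat_real ?D z * a n \<omega> z) \<le> indicat_real ?D z * K" for n
        using K by (auto simp: indicator_def a_def)
      show "AE z in L1 \<omega>. (\<lambda>n. indicat_real ?D z * a n \<omega> z) \<longlonglongrightarrow> indicat_real ?D z * g (Y (fst z) \<omega>, snd z)"
      proof (rule AE_I2)
        fix z
        show "(\<lambda>n. indicat_real ?D z * a n \<omega> z) \<longlonglongrightarrow> indicat_real ?D z * g (Y (fst z) \<omega>, snd z)"
        proof (cases "z \<in> ?D")
          case True
          then have z: "0 \<le> fst z" "fst z \<le> t" by (auto simp: mem_Times_iff)
          have "(\<lambda>n. Y (q n \<lceil>m n * fst z\<rceil>) \<omega>) \<longlonglongrightarrow> Y (fst z) \<omega>"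
            unfolding q_def m_def using z
            by (intro tendsto_min_grid_ceiling[where w="\<lambda>s. Y s \<omega>"] Y_right_continuous[OF \<omega>]) auto
          then have "(\<lambda>n. (Y (q n \<lceil>m n * fst z\<rceil>) \<omega>, p n (snd z))) \<longlonglongrightarrow> (Y (fst z) \<omega>, snd z)"
            by (intro tendsto_Pair p_lim)
          then have "(\<lambda>n. a n \<omega> z) \<longlonglongrightarrow> g (Y (fst z) \<omega>, snd z)"
            unfolding a_def by (rule continuous_on_tendsto_compose[OF g]) auto
          then show ?thesis by (intro tendsto_mult tendsto_const)
        qed simp
      qed
    qed
  qed
qed

text \<open>This is the value taken where \<open>\<tau>\<close> is infinite. The Bochner integral is
  0 unless the integrand is integrable, so the two cases are separated measurably: integrability
  means that the truncated integrals of |g| have a finite supremum, and then the truncated integrals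
  of \<open>g\<close> converge to the value.\<close>

lemma control_integral_total_measurable:
  assumes g: "continuous_on UNIV g"
  shows "control_integral g {0..} \<in> borel_measurable (F \<infinity>)"
proof -
  have g_borel: "g \<in> borel_measurable borel" by (rule borel_measurable_continuous_onI[OF g])
  have abs_g: "continuous_on UNIV (\<lambda>x. \<bar>g x\<bar>)" using g by (intro continuous_intros)
  then have abs_borel: "(\<lambda>x. \<bar>g x\<bar>) \<in> borel_measurable borel" by (rule borel_measurable_continuous_onI)
  obtain K where K: "0 \<le> K" "\<And>x. \<bar>g x\<bar> \<le> K"
    using compact_UNIV_bounded[OF _ g] compact_Times[OF compact_E compact_U] by auto
  have meas: "control_integral h {0..real n} \<in> borel_measurable (F \<infinity>)" if "continuous_on UNIV h" for h n
    by (rule measurable_mono[OF control_integral_adapted[OF that]]) auto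
  note [measurable] = meas[OF g] meas[OF abs_g]
  have "(\<lambda>\<omega>. if (SUP n. ennreal (control_integral (\<lambda>x. \<bar>g x\<bar>) {0..real n} \<omega>)) < \<infinity>
      then lim (\<lambda>n. control_integral g {0..real n} \<omega>) else 0) \<in> borel_measurable (F \<infinity>)"
    by measurable
  then show ?thesis
  proof (rule measurable_cong[THEN iffD1, rotated])
    fix \<omega> assume "\<omega> \<in> space (F \<infinity>)"
    then have \<omega>: "\<omega> \<in> space M" by (simp add: space_F)
    let ?g = "\<lambda>z. g (Y (fst z) \<omega>, snd z)" and ?D = "\<lambda>n. {0..real n} \<times> (UNIV :: 'u set)"
    note gm[measurable] = integrand_measurable[OF \<omega> g_borel]
    have D[measurable]: "?D n \<in> sets (L1 \<omega>)" for n by (rule Times_sets_L1[OF \<omega>]) auto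
    have lim_ind: "(\<lambda>n. indicator (?D n) z * c) \<longlonglongrightarrow> c" if z: "z \<in> space (L1 \<omega>)" for z and c :: real
    proof -
      have "eventually (\<lambda>n. fst z \<le> real n) sequentially"
        by (meson eventually_sequentiallyI of_nat_mono order_trans real_arch_simple)
      then have "eventually (\<lambda>n. indicator (?D n) z * c = c) sequentially"
        by eventually_elim (use z in \<open>auto simp: space_L1[OF \<omega>] indicator_def mem_Times_iff\<close>)
      then show ?thesis by (rule tendsto_eventually)
    qed
    have total: "control_integral g {0..} \<omega> = integral\<^sup>L (L1 \<omega>) ?g"
      unfolding control_integral_def set_lebesgue_integral_def
      by (intro Bochner_Integration.integral_cong) (auto simp: space_L1[OF \<omega>])
    have abs_n: "ennreal (control_integral (\<lambda>x. \<bar>g x\<bar>) {0..real n} \<omega>) =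
        (\<integral>\<^sup>+z. ennreal (indicator (?D n) z * \<bar>?g z\<bar>) \<partial>L1 \<omega>)" for n
    proof -
      have "set_integrable (L1 \<omega>) (?D n) (\<lambda>z. \<bar>?g z\<bar>)"
        by (rule set_integral_increment_bound(1)[of "{}" _ _ _ K])
          (use K emeasure_L1_finite[OF \<omega>, of "real n" UNIV] in \<open>auto simp: set_borel_measurable_def\<close>)
      then show ?thesis
        unfolding control_integral_def set_lebesgue_integral_def set_integrable_def
        by (subst nn_integral_eq_integral) auto
    qed
    have "(SUP n. ennreal (control_integral (\<lambda>x. \<bar>g x\<bar>) {0..real n} \<omega>)) =
        (\<integral>\<^sup>+z. (SUP n. ennreal (indicator (?D n) z * \<bar>?g z\<bar>)) \<partial>L1 \<omega>)"
      unfolding abs_n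
      by (rule nn_integral_monotone_convergence_SUP[symmetric])
        (auto intro!: incseq_SucI le_funI ennreal_leI simp: indicator_def)
    also have "\<dots> = (\<integral>\<^sup>+z. ennreal (norm (?g z)) \<partial>L1 \<omega>)"
    proof (rule nn_integral_cong)
      fix z assume z: "z \<in> space (L1 \<omega>)"
      have "incseq (\<lambda>n. ennreal (indicator (?D n) z * \<bar>?g z\<bar>))"
        by (auto intro!: incseq_SucI ennreal_leI simp: indicator_def)
      from LIMSEQ_SUP[OF this] tendsto_ennrealI[OF lim_ind[OF z, of "\<bar>?g z\<bar>"]]
      show "(SUP n. ennreal (indicator (?D n) z * \<bar>?g z\<bar>)) = ennreal (norm (?g z))"
        by (simp add: LIMSEQ_unique)
    qed
    finally have SUP_eq: "(SUP n. ennreal (control_integral (\<lambda>x. \<bar>g x\<bar>) {0..real n} \<omega>)) =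
        (\<integral>\<^sup>+z. ennreal (norm (?g z)) \<partial>L1 \<omega>)" .
    show "(if (SUP n. ennreal (control_integral (\<lambda>x. \<bar>g x\<bar>) {0..real n} \<omega>)) < \<infinity>
        then lim (\<lambda>n. control_integral g {0..real n} \<omega>) else 0) = control_integral g {0..} \<omega>"
    proof (cases "integrable (L1 \<omega>) ?g")
      case True
      have "(\<lambda>n. control_integral g {0..real n} \<omega>) \<longlonglongrightarrow> integral\<^sup>L (L1 \<omega>) ?g"
        unfolding control_integral_def set_lebesgue_integral_def real_scaleR_def
      proof (rule integral_dominated_convergence[where w="\<lambda>z. norm (?g z)"])
        show "AE z in L1 \<omega>. (\<lambda>n. indicat_real (?D n) z * ?g z) \<longlonglongrightarrow> ?g z"
          by (intro AE_I2 lim_ind)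
      qed (use True in \<open>auto simp: indicator_def\<close>)
      then show ?thesis using True unfolding SUP_eq total integrable_iff_bounded by (auto intro: limI)
    next
      case False
      then show ?thesis
        unfolding SUP_eq total using not_integrable_integral_eq[OF False] by (simp add: integrable_iff_bounded)
    qed
  qed
qed

end

section \<open>The time change\<close>

context compact_controlled_solution
begin

abbreviation \<tau> :: "ennreal \<Rightarrow> 'w \<Rightarrow> ennreal" where "\<tau> \<equiv> inverse_clock l0"

definition G :: "ennreal \<Rightarrow> 'w measure" where "G t = pre_sigma (\<tau> t)"

abbreviation X :: "real \<Rightarrow> 'w \<Rightarrow> 'e" where "X \<equiv> time_changed Y l0"

abbreviation (input) path :: "'w \<Rightarrow> real \<Rightarrow> real" where "path \<omega> \<equiv> (\<lambda>t. l0 t \<omega>)"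

lemma \<tau>_eq_icl: "\<omega> \<in> space M \<Longrightarrow> \<tau> t \<omega> = clock_path.icl (path \<omega>) t"
  by (simp add: inverse_clock_def clock_path.icl_def[OF clock_path])

lemma enn2real_\<tau>: "\<omega> \<in> space M \<Longrightarrow> enn2real (\<tau> (ennreal t) \<omega>) = clock_path.tr (path \<omega>) t"
  by (simp add: \<tau>_eq_icl clock_path.tr_def[OF clock_path])

lemma X_eq: "\<omega> \<in> space M \<Longrightarrow> X t \<omega> = Y (clock_path.tr (path \<omega>) t) \<omega>"
  by (simp add: time_changed_def enn2real_\<tau>)

lemma \<tau>_mono: "\<omega> \<in> space M \<Longrightarrow> s \<le> t \<Longrightarrow> \<tau> s \<omega> \<le> \<tau> t \<omega>"
  by (simp add: \<tau>_eq_icl clock_path.icl_mono[OF clock_path])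

lemma \<tau>_less_iff: "\<omega> \<in> space M \<Longrightarrow> 0 \<le> s \<Longrightarrow> \<tau> t \<omega> < ennreal s \<longleftrightarrow> t < ennreal (l0 s \<omega>)"
  by (simp add: \<tau>_eq_icl clock_path.icl_less_iff[OF clock_path])

lemma stopping_time_\<tau>: "stopping_time F (\<tau> t)"
proof (rule stopping_time_right_continuousI[OF right_continuous_F])
  fix s :: real assume s: "0 < s"
  have "{\<omega> \<in> space M. \<tau> t \<omega> < ennreal s} = {\<omega> \<in> space (F (ennreal s)). t < ennreal (l0 s \<omega>)}"
    using s by (auto simp: \<tau>_less_iff space_F)
  also have "\<dots> \<in> sets (F (ennreal s))"
  proof -
    have [measurable]: "l0 s \<in> borel_measurable (F (ennreal s))" using s by (intro l0_adapted) simp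
    show ?thesis by measurable
  qed
  finally show "{\<omega> \<in> space M. \<tau> t \<omega> < ennreal s} \<in> sets (F (ennreal s))" .
qed

lemma subalgebra_G: "subalgebra M (G t)"
proof -
  have "A \<in> sets M" if "A \<in> sets (G t)" for A
    using sets_pre_sigmaD[OF stopping_time_\<tau>, of A t \<infinity>] that sets_F_subset by (auto simp: G_def)
  then show ?thesis by (auto simp: subalgebra_def G_def space_pre_sigma)
qed

sublocale G: filtered_prob_space M G
proof
  show "space (G t) = space M" for t by (simp add: G_def space_pre_sigma)
  show "sets (G s) \<subseteq> sets (G t)" if "s \<le> t" for s t
    unfolding G_def using that by (intro mono_pre_sigma stopping_time_\<tau> \<tau>_mono)
qed (rule subalgebra_G)

text \<open>\<tau>(\<sigma>) < s means \<sigma> < l0 s, so some rational q satisfies \<sigma> \<le>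
  q < l0 s, and then \<tau>(q) < s. The event \<sigma> \<le> q belongs to G(q), which is
  \<open>F\<close> stopped at \<tau>(q), so its part with \<tau>(q) \<le> s lies in F(s).\<close>

lemma stopping_time_\<tau>_compose:
  assumes \<sigma>: "stopping_time G \<sigma>"
  shows "stopping_time F (\<lambda>\<omega>. \<tau> (\<sigma> \<omega>) \<omega>)"
proof (rule stopping_time_right_continuousI[OF right_continuous_F])
  fix s :: real assume s: "0 < s"
  define H where "H q = {\<omega> \<in> space M. \<sigma> \<omega> \<le> ennreal (of_rat q)}" for q :: rat
  have H: "H q \<in> sets (pre_sigma (\<tau> (ennreal (of_rat q))))" for q
    using stopping_timeD[OF \<sigma>, of "ennreal (of_rat q)"]
    by (simp add: H_def Measurable.pred_def G_def space_pre_sigma)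
  \<comment> \<open>The condition with \<le> follows from the strict one; it is written out because
    \<open>pre_sigma\<close> is tested with \<le>. A negative q counts as 0 under
    \<open>ennreal\<close>, and monotonicity of \<open>\<tau>\<close> treats it like the
    others.\<close>
  have "{\<omega> \<in> space M. \<tau> (\<sigma> \<omega>) \<omega> < ennreal s} =
      (\<Union>q. {\<omega> \<in> H q. \<tau> (ennreal (of_rat q)) \<omega> \<le> ennreal s} \<inter>
        {\<omega> \<in> space (F (ennreal s)). \<tau> (ennreal (of_rat q)) \<omega> < ennreal s})"
  proof (intro set_eqI iffI)
    fix \<omega> assume "\<omega> \<in> {\<omega> \<in> space M. \<tau> (\<sigma> \<omega>) \<omega> < ennreal s}"
    then have \<omega>: "\<omega> \<in> space M" and less: "\<sigma> \<omega> < ennreal (l0 s \<omega>)"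
      using s by (auto simp: \<tau>_less_iff)
    then obtain r where r: "\<sigma> \<omega> = ennreal r" "0 \<le> r" by (cases "\<sigma> \<omega>") auto
    with less have "r < l0 s \<omega>" by (simp add: ennreal_less_iff)
    then obtain q where q: "r < of_rat q" "of_rat q < l0 s \<omega>" using of_rat_dense by blast
    then have "\<tau> (ennreal (of_rat q)) \<omega> < ennreal s"
      using r s by (subst \<tau>_less_iff[OF \<omega>]) (auto intro: ennreal_lessI)
    moreover have "\<sigma> \<omega> \<le> ennreal (of_rat q)" using r q by (auto intro: ennreal_leI)
    ultimately show "\<omega> \<in> (\<Union>q. {\<omega> \<in> H q. \<tau> (ennreal (of_rat q)) \<omega> \<le> ennreal s} \<inter>
        {\<omega> \<in> space (F (ennreal s)). \<tau> (ennreal (of_rat q)) \<omega> < ennreal s})"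
      using \<omega> by (auto simp: H_def space_F intro!: exI[of _ q])
  next
    fix \<omega> assume "\<omega> \<in> (\<Union>q. {\<omega> \<in> H q. \<tau> (ennreal (of_rat q)) \<omega> \<le> ennreal s} \<inter>
        {\<omega> \<in> space (F (ennreal s)). \<tau> (ennreal (of_rat q)) \<omega> < ennreal s})"
    then obtain q where \<omega>: "\<omega> \<in> space M" and "\<sigma> \<omega> \<le> ennreal (of_rat q)"
        and less: "\<tau> (ennreal (of_rat q)) \<omega> < ennreal s"
      by (auto simp: H_def)
    with le_less_trans[OF \<tau>_mono less] show "\<omega> \<in> {\<omega> \<in> space M. \<tau> (\<sigma> \<omega>) \<omega> < ennreal s}"
      by simp
  qed
  also have "\<dots> \<in> sets (F (ennreal s))"
  proof (intro sets.countable_UN'' sets.Int)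
    fix q
    show "{\<omega> \<in> H q. \<tau> (ennreal (of_rat q)) \<omega> \<le> ennreal s} \<in> sets (F (ennreal s))"
      by (rule sets_pre_sigmaD[OF stopping_time_\<tau> H])
    show "{\<omega> \<in> space (F (ennreal s)). \<tau> (ennreal (of_rat q)) \<omega> < ennreal s} \<in> sets (F (ennreal s))"
      using stopping_time_less_const[OF stopping_time_\<tau>] by (simp add: Measurable.pred_def)
  qed auto
  finally show "{\<omega> \<in> space M. \<tau> (\<sigma> \<omega>) \<omega> < ennreal s} \<in> sets (F (ennreal s))" .
qed

section \<open>Adaptedness and right continuity of the time-changed terms\<close>

lemma X_adapted: "0 \<le> t \<Longrightarrow> X t \<in> G (ennreal t) \<rightarrow>\<^sub>M borel"
proof -
  \<comment> \<open>\<open>enn2real\<close> sends \<infinity> to 0, so \<open>X t\<close> already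
    equals \<open>Y 0\<close> where \<open>\<tau>\<close> is infinite; the case distinction exhibits
    the value that the measurability lemma wants there.\<close>
  have "(\<lambda>\<omega>. if \<tau> (ennreal t) \<omega> = \<infinity> then Y 0 \<omega> else Y (enn2real (\<tau> (ennreal t) \<omega>)) \<omega>)
      \<in> G (ennreal t) \<rightarrow>\<^sub>M borel"
    unfolding G_def
    by (rule pre_sigma_measurable_at_stopping_time[OF stopping_time_\<tau>])
      (auto intro: Y_adapted Y_right_continuous measurable_mono[OF Y_adapted])
  moreover have "(\<lambda>\<omega>. if \<tau> (ennreal t) \<omega> = \<infinity> then Y 0 \<omega> else Y (enn2real (\<tau> (ennreal t) \<omega>)) \<omega>) = X t"
    by (auto simp: time_changed_def)
  ultimately show ?thesis by simp
qed

lemma X_right_continuous: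
  assumes \<omega>: "\<omega> \<in> space M" and t: "0 \<le> t"
  shows "((\<lambda>t. X t \<omega>) \<longlongrightarrow> X t \<omega>) (at_right t)"
proof -
  interpret c: clock_path "path \<omega>" by (rule clock_path[OF \<omega>])
  have "(if c.icl (ennreal s) = \<infinity> then Y 0 \<omega> else Y (c.tr s) \<omega>) = X s \<omega>" for s
    by (auto simp: X_eq[OF \<omega>] c.tr_def)
  then show ?thesis
    using c.right_continuous_time_change[OF t, of "\<lambda>s. Y s \<omega>" "Y 0 \<omega>"] Y_right_continuous[OF \<omega>] by simp
qed

lemma X_path_measurable:
  fixes a :: "'e \<Rightarrow> real"
  assumes \<omega>: "\<omega> \<in> space M" and a: "a \<in> borel_measurable borel"
  shows "set_borel_measurable lborel {0..t} (\<lambda>s. a (X s \<omega>))"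
proof -
  have "(\<lambda>s. X (max 0 s) \<omega>) \<in> borel_measurable lborel"
    by (rule measurable_compose_right_continuous_unbounded[where W="\<lambda>s _. X s \<omega>"])
      (auto intro: X_right_continuous[OF \<omega>])
  then have "(\<lambda>s. indicat_real {0..t} s *\<^sub>R a (X (max 0 s) \<omega>)) \<in> borel_measurable lborel"
    using measurable_compose[OF _ a] by (intro borel_measurable_scaleR) auto
  then show ?thesis unfolding set_borel_measurable_def
    by (rule measurable_cong[THEN iffD1, rotated]) (auto simp: indicator_def)
qed

text \<open>Measurability of the parameter integral needs the integrand jointly measurable in
  \<omega> and s with respect to G(t), not merely \<open>M\<close>. Clamping s into [0,t] lets only
  values of \<open>X\<close> up to time \<open>t\<close> enter.\<close>

lemma time_integral_adapted:
  fixes a :: "'e \<Rightarrow> real"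
  assumes a: "a \<in> borel_measurable borel" and t: "0 \<le> t"
  shows "(\<lambda>\<omega>. LINT s:{0..t}|lborel. a (X s \<omega>)) \<in> borel_measurable (G (ennreal t))"
proof -
  have "(\<lambda>z. X (max 0 (min t (snd z))) (fst z)) \<in> G (ennreal t) \<Otimes>\<^sub>M lborel \<rightarrow>\<^sub>M borel"
  proof (rule measurable_compose_right_continuous[where t=t and W="\<lambda>s z. X s (fst z)"])
    show "(\<lambda>z. X s (fst z)) \<in> G (ennreal t) \<Otimes>\<^sub>M lborel \<rightarrow>\<^sub>M borel" if "0 \<le> s" "s \<le> t" for s
      by (rule measurable_compose[OF measurable_fst G.measurable_mono[OF X_adapted]])
        (use that in \<open>auto intro: ennreal_leI\<close>)
  qed (use t in \<open>auto simp: space_pair_measure G.space_F intro: X_right_continuous\<close>)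
  from measurable_compose[OF this a]
  have "(\<lambda>(\<omega>, s). indicat_real {0..t} s *\<^sub>R a (X (max 0 (min t s)) \<omega>)) \<in> borel_measurable (G (ennreal t) \<Otimes>\<^sub>M lborel)"
    by (auto simp: case_prod_beta intro!: borel_measurable_times)
  from lborel.borel_measurable_lebesgue_integral[OF this]
  have "(\<lambda>\<omega>. LINT s|lborel. indicat_real {0..t} s *\<^sub>R a (X (max 0 (min t s)) \<omega>)) \<in> borel_measurable (G (ennreal t))" .
  moreover have "(LINT s|lborel. indicat_real {0..t} s *\<^sub>R a (X (max 0 (min t s)) \<omega>)) = (LINT s:{0..t}|lborel. a (X s \<omega>))" for \<omega>
    unfolding set_lebesgue_integral_def
    by (rule Bochner_Integration.integral_cong) (auto simp: indicator_def)
  ultimately show ?thesis by simp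
qed

lemma time_integral_right_continuous:
  fixes a :: "'e \<Rightarrow> real"
  assumes \<omega>: "\<omega> \<in> space M" and a: "a \<in> borel_measurable borel" and K: "\<And>x. \<bar>a x\<bar> \<le> K" and s: "0 \<le> s"
  shows "((\<lambda>t. LINT r:{0..t}|lborel. a (X r \<omega>)) \<longlongrightarrow> (LINT r:{0..s}|lborel. a (X r \<omega>))) (at_right s)"
proof (rule tendsto_at_right_Lipschitz[where K=K])
  fix t assume st: "s \<le> t"
  have "\<bar>(LINT r:{0..t}|lborel. a (X r \<omega>)) - (LINT r:{0..s}|lborel. a (X r \<omega>))\<bar> \<le> K * measure lborel ({0..t} - {0..s})"
    by (rule set_integral_increment_bound) (use st s X_path_measurable[OF \<omega> a] K in auto)
  also have "{0..t} - {0..s} = {s<..t}" using s by auto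
  finally show "\<bar>(LINT r:{0..t}|lborel. a (X r \<omega>)) - (LINT r:{0..s}|lborel. a (X r \<omega>))\<bar> \<le> K * (t - s)"
    using st by simp
qed

text \<open>The integral against \<open>\<Lambda>\<close>, pulled back to \<open>L1\<close>.
  Comparing times in \<open>ennreal\<close> makes the time set all of [0,\<infinity>) where
  \<open>\<tau>\<close> is infinite, as in the property that characterizes
  \<open>\<Lambda>\<close>.\<close>

definition changed_control_integral :: "('e \<times> 'u \<Rightarrow> real) \<Rightarrow> real \<Rightarrow> 'w \<Rightarrow> real" where
  "changed_control_integral g t \<omega> = control_integral g {s. 0 \<le> s \<and> ennreal s \<le> \<tau> (ennreal t) \<omega>} \<omega>"

lemma changed_control_integral_eq:
  "changed_control_integral g t \<omega> =
    (if \<tau> (ennreal t) \<omega> = \<infinity> then control_integral g {0..} \<omega>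
     else control_integral g {0..enn2real (\<tau> (ennreal t) \<omega>)} \<omega>)"
proof (cases "\<tau> (ennreal t) \<omega>")
  case (real r)
  then have "{s. 0 \<le> s \<and> ennreal s \<le> \<tau> (ennreal t) \<omega>} = {0..r}" by auto
  then show ?thesis using real by (simp add: changed_control_integral_def)
next
  case top
  then have "{s. 0 \<le> s \<and> ennreal s \<le> \<tau> (ennreal t) \<omega>} = {0..}" by auto
  then show ?thesis using top by (simp add: changed_control_integral_def)
qed

lemma changed_control_integral_adapted:
  assumes g: "continuous_on UNIV g"
  shows "changed_control_integral g t \<in> borel_measurable (G (ennreal t))"
proof -
  obtain K where K: "0 \<le> K" "\<And>x. \<bar>g x\<bar> \<le> K"
    using compact_UNIV_bounded[OF _ g] compact_Times[OF compact_E compact_U] by auto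
  have g_borel: "g \<in> borel_measurable borel" by (rule borel_measurable_continuous_onI[OF g])
  show ?thesis
    unfolding changed_control_integral_eq[abs_def] G_def
    by (intro pre_sigma_measurable_at_stopping_time[where W="\<lambda>s. control_integral g {0..s}"]
        stopping_time_\<tau> control_integral_adapted[OF g] control_integral_total_measurable[OF g]
        control_integral_right_continuous[OF _ _ g_borel K(2)])
qed

lemma changed_control_integral_right_continuous:
  assumes \<omega>: "\<omega> \<in> space M" and t: "0 \<le> t" and g: "g \<in> borel_measurable borel" and K: "\<And>x. \<bar>g x\<bar> \<le> K"
  shows "((\<lambda>t. changed_control_integral g t \<omega>) \<longlongrightarrow> changed_control_integral g t \<omega>) (at_right t)"
proof -
  interpret c: clock_path "path \<omega>" by (rule clock_path[OF \<omega>])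
  have "changed_control_integral g s \<omega> =
      (if c.icl (ennreal s) = \<infinity> then control_integral g {0..} \<omega> else control_integral g {0..c.tr s} \<omega>)" for s
    unfolding changed_control_integral_eq \<tau>_eq_icl[OF \<omega>] c.tr_def ..
  then show ?thesis
    using c.right_continuous_time_change[OF t, of "\<lambda>s. control_integral g {0..s} \<omega>" "control_integral g {0..} \<omega>"]
      control_integral_right_continuous[OF \<omega> _ g K] by simp
qed

text \<open>The image of \<open>\<Lambda>\<close> on \<open>[0,t] \<times> \<Xi>\<close> under the projection to \<open>\<Xi>\<close> is the image of \<open>L1\<close> on
  \<open>[0,\<tau>(t)] \<times> U\<close> under \<open>(s,u) \<mapsto> (Y s, u)\<close>, whether or not these measures are finite.\<close>

lemma integral_image_measure:
  assumes \<omega>: "\<omega> \<in> space M" and t: "0 \<le> t"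
    and sets: "sets N = sets (restrict_space borel ({0..} \<times> \<Xi>))"
    and N: "\<And>C. C \<in> sets borel \<Longrightarrow> C \<subseteq> \<Xi> \<Longrightarrow> emeasure N ({0..t} \<times> C) =
          (\<integral>\<^sup>+z\<in>{s. 0 \<le> s \<and> ennreal s \<le> \<tau> (ennreal t) \<omega>} \<times> UNIV. indicator C (Y (fst z) \<omega>, snd z) \<partial>L1 \<omega>)"
    and g: "g \<in> borel_measurable borel" and h: "\<And>x. x \<in> \<Xi> \<Longrightarrow> h x = g x"
  shows "(LINT z:{0..t} \<times> \<Xi>|N. h (snd z)) = changed_control_integral g t \<omega>"
proof -
  let ?S = "{s. 0 \<le> s \<and> ennreal s \<le> \<tau> (ennreal t) \<omega>}" and ?pos = "\<lambda>z. (Y (fst z) \<omega>, snd z)"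
  have \<Xi>: "\<Xi> \<in> sets borel" using closed_\<Xi> by simp
  have half: "{0::real..} \<times> \<Xi> \<in> sets borel" by (intro borel_Times \<Xi>) auto
  have space_N: "space N = {0..} \<times> \<Xi>"
    using sets_eq_imp_space_eq[OF sets] half by simp
  have sets_N: "{0..t} \<times> C \<in> sets N" if "C \<in> sets borel" "C \<subseteq> \<Xi>" for C
    using that half by (auto simp: sets sets_restrict_space_iff intro!: borel_Times)
  have "(snd :: real \<times> 'e \<times> 'u \<Rightarrow> _) \<in> borel \<rightarrow>\<^sub>M borel"
    by (intro borel_measurable_continuous_onI continuous_intros)
  then have snd_N: "snd \<in> N \<rightarrow>\<^sub>M borel"
    by (subst measurable_cong_sets[OF sets refl]) (rule measurable_restrict_space1)
  have S: "?S \<times> UNIV \<in> sets (L1 \<omega>)"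
  proof (rule Times_sets_L1[OF \<omega>])
    have "?S = {0..} \<inter> {s. ennreal s \<le> \<tau> (ennreal t) \<omega>}" by auto
    then show "?S \<in> sets borel" by simp
  qed auto
  note pos = position_measurable[OF \<omega>]
  define N1 where "N1 = distr (density N (\<lambda>z. ennreal (indicat_real ({0..t} \<times> \<Xi>) z))) borel snd"
  define N2 where "N2 = distr (density (L1 \<omega>) (\<lambda>z. ennreal (indicat_real (?S \<times> UNIV) z))) borel ?pos"
  have "N1 = N2"
  proof (rule measure_eqI)
    fix C assume "C \<in> sets N1"
    then have C: "C \<in> sets borel" by (simp add: N1_def)
    have "emeasure N1 C = emeasure (density N (\<lambda>z. ennreal (indicat_real ({0..t} \<times> \<Xi>) z))) (snd -` C \<inter> space N)"
      unfolding N1_def using C snd_N by (subst emeasure_distr) auto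
    also have "\<dots> = (\<integral>\<^sup>+z. ennreal (indicat_real ({0..t} \<times> \<Xi>) z) * indicator (snd -` C \<inter> space N) z \<partial>N)"
      using measurable_sets[OF snd_N C] sets_N[OF \<Xi>] by (subst emeasure_density) auto
    also have "\<dots> = (\<integral>\<^sup>+z. indicator ({0..t} \<times> (C \<inter> \<Xi>)) z \<partial>N)"
      by (intro nn_integral_cong) (auto simp: indicator_def space_N)
    also have "\<dots> = emeasure N ({0..t} \<times> (C \<inter> \<Xi>))"
      using C \<Xi> by (intro nn_integral_indicator sets_N) auto
    also have "\<dots> = (\<integral>\<^sup>+z\<in>?S \<times> UNIV. indicator (C \<inter> \<Xi>) (?pos z) \<partial>L1 \<omega>)"
      using C \<Xi> by (intro N) auto
    also have "\<dots> = (\<integral>\<^sup>+z. ennreal (indicat_real (?S \<times> UNIV) z) * indicator (?pos -` C \<inter> space (L1 \<omega>)) z \<partial>L1 \<omega>)"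
    \<comment> \<open>\<open>L1\<close> is carried by the points whose position and control form a
      pair in \<open>\<Xi>\<close>, so intersecting \<open>C\<close> with \<open>\<Xi>\<close>
      changes the integrand only on a null set.\<close>
    proof (rule nn_integral_cong_AE)
      show "AE z in L1 \<omega>. indicator (C \<inter> \<Xi>) (?pos z) * indicator (?S \<times> UNIV) z =
        ennreal (indicat_real (?S \<times> UNIV) z) * indicator (?pos -` C \<inter> space (L1 \<omega>)) z"
        using AE_L1_carrier[OF \<omega>] AE_space by eventually_elim (auto simp: indicator_def)
    qed
    also have "\<dots> = emeasure (density (L1 \<omega>) (\<lambda>z. ennreal (indicat_real (?S \<times> UNIV) z))) (?pos -` C \<inter> space (L1 \<omega>))"
      using measurable_sets[OF pos C] S by (subst emeasure_density) auto
    also have "\<dots> = emeasure N2 C"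
      unfolding N2_def using C pos by (subst emeasure_distr) auto
    finally show "emeasure N1 C = emeasure N2 C" .
  qed (simp add: N1_def N2_def)
  then have "integral\<^sup>L N1 g = integral\<^sup>L N2 g" by simp
  moreover have "integral\<^sup>L N1 g = (LINT z:{0..t} \<times> \<Xi>|N. h (snd z))"
  proof -
    have "integral\<^sup>L N1 g = (LINT z|density N (\<lambda>z. ennreal (indicat_real ({0..t} \<times> \<Xi>) z)). g (snd z))"
      unfolding N1_def using snd_N g by (intro integral_distr) auto
    also have "\<dots> = (LINT z|N. indicat_real ({0..t} \<times> \<Xi>) z *\<^sub>R g (snd z))"
      using measurable_compose[OF snd_N g] sets_N[OF \<Xi>] by (intro integral_density) auto
    also have "\<dots> = (LINT z:{0..t} \<times> \<Xi>|N. h (snd z))"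
      unfolding set_lebesgue_integral_def
      by (intro Bochner_Integration.integral_cong) (auto simp: indicator_def h)
    finally show ?thesis .
  qed
  moreover have "integral\<^sup>L N2 g = changed_control_integral g t \<omega>"
  proof -
    have "integral\<^sup>L N2 g = (LINT z|density (L1 \<omega>) (\<lambda>z. ennreal (indicat_real (?S \<times> UNIV) z)). g (?pos z))"
      unfolding N2_def using pos g by (intro integral_distr) auto
    also have "\<dots> = changed_control_integral g t \<omega>"
      unfolding changed_control_integral_def control_integral_def set_lebesgue_integral_def
      using integrand_measurable[OF \<omega> g] S by (intro integral_density) auto
    finally show ?thesis .
  qed
  ultimately show ?thesis by simp
qed

lemma op_val_B: "f \<in> Domain B \<Longrightarrow> op_val B f \<in> cont_funs \<Xi>"
proof -
  assume "f \<in> Domain B"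
  then obtain b where b: "(f, b) \<in> B" by auto
  have "op_val B f = b"
    unfolding op_val_def using b single_valued_B by (auto dest: single_valuedD)
  then show ?thesis using b Range_B by auto
qed

lemma control_integral_op_val_B:
  assumes \<omega>: "\<omega> \<in> space M" and h: "h \<in> cont_funs \<Xi>" and g: "continuous_on UNIV g"
    and eq: "\<And>x. x \<in> \<Xi> \<Longrightarrow> g x = h x" and t: "0 \<le> t"
  shows "(LINT z:{0..t} \<times> UNIV|L1 \<omega>. h (Y (fst z) \<omega>, snd z)) = control_integral g {0..t} \<omega>"
proof -
  have g_borel: "g \<in> borel_measurable borel" by (rule borel_measurable_continuous_onI[OF g])
  \<comment> \<open>Extensionality makes \<open>h\<close> constant off \<open>\<Xi>\<close>, hence
    Borel on the whole product, as the almost everywhere comparison requires.\<close>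
  have "h = (\<lambda>x. if x \<in> \<Xi> then g x else undefined)"
    using h eq by (auto simp: cont_funs_def extensional_def)
  moreover have "(\<lambda>x. if x \<in> \<Xi> then g x else undefined) \<in> borel_measurable borel"
    using g_borel closed_\<Xi> by (intro measurable_If_set) auto
  ultimately have h_borel: "h \<in> borel_measurable borel" by simp
  show ?thesis
    unfolding control_integral_def
  proof (rule set_lebesgue_integral_cong_AE)
    show "AE z\<in>{0..t} \<times> UNIV in L1 \<omega>. h (Y (fst z) \<omega>, snd z) = g (Y (fst z) \<omega>, snd z)"
      using AE_L1_carrier[OF \<omega>] by eventually_elim (simp add: eq)
  qed (use integrand_measurable[OF \<omega>] g_borel h_borel Times_sets_L1[OF \<omega>, of "{0..t}" UNIV] in auto)
qed

lemma Y_path_measurable: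
  assumes \<omega>: "\<omega> \<in> space M" and a: "a \<in> borel_measurable borel"
  shows "(\<lambda>r. a (Y (max 0 r) \<omega>)) \<in> borel_measurable borel"
proof (rule measurable_compose[OF _ a])
  show "(\<lambda>r. Y (max 0 r) \<omega>) \<in> borel \<rightarrow>\<^sub>M borel"
    by (rule measurable_compose_right_continuous_unbounded[where W="\<lambda>s _. Y s \<omega>"])
      (auto intro: Y_right_continuous[OF \<omega>])
qed

section \<open>Path regularity and the local martingale property\<close>

lemma time_changed_in_skorohod_paths:
  assumes \<omega>: "\<omega> \<in> space M" and fin: "\<And>t. \<tau> (ennreal t) \<omega> \<noteq> \<infinity>"
  shows "(\<lambda>t. X t \<omega>) \<in> skorohod_paths (closure E0)"
proof -
  interpret c: clock_path "path \<omega>" by (rule clock_path[OF \<omega>])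
  have fin': "c.icl (ennreal t) \<noteq> \<infinity>" for t using fin[of t] \<tau>_eq_icl[OF \<omega>] by simp
  have in_cl: "X t \<omega> \<in> closure E0" if "0 \<le> t" for t
    unfolding X_eq[OF \<omega>]
    by (rule c.time_change_in_closed[OF that fin' closed_closure, of "\<lambda>t. Y t \<omega>"])
      (auto intro: Y_right_continuous[OF \<omega>] l0_increase[OF \<omega>])
  have "\<exists>l\<in>closure E0. ((\<lambda>t. X t \<omega>) \<longlongrightarrow> l) (at_left t)" if t: "0 < t" for t
  proof -
    obtain b where b: "0 < b" "filterlim c.tr (at_left b) (at_left t)"
      using c.filterlim_tr_at_left[OF t fin'] by blast
    obtain l where "((\<lambda>t. Y t \<omega>) \<longlongrightarrow> l) (at_left b)"
      using Y_paths[OF \<omega>] b(1) by (auto simp: skorohod_paths_def)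
    from filterlim_compose[OF this b(2)] have l: "((\<lambda>t. X t \<omega>) \<longlongrightarrow> l) (at_left t)"
      by (simp add: X_eq[OF \<omega>])
    have "eventually (\<lambda>s. X s \<omega> \<in> closure E0) (at_left t)"
      unfolding eventually_at_left_field using t in_cl by (intro exI[of _ 0]) auto
    \<comment> \<open>\<open>Y\<close> may be outside \<open>closure E0\<close> just before
      \<open>b\<close>; only the values of \<open>X\<close> are known to lie there, so closedness is
      used along \<open>X\<close>.\<close>
    then have "l \<in> closure E0"
      using l by (intro Lim_in_closed_set[OF closed_closure _ _ l]) auto
    with l show ?thesis by blast
  qed
  then show ?thesis
    using in_cl X_right_continuous[OF \<omega>] by (auto simp: skorohod_paths_def)
qed

lemma \<tau>_finite:
  assumes \<omega>: "\<omega> \<in> space M" and lim: "filterlim (\<lambda>t. l0 t \<omega>) at_top at_top"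
  shows "\<tau> (ennreal t) \<omega> \<noteq> \<infinity>"
proof -
  have "eventually (\<lambda>s. max 0 t < l0 s \<omega> \<and> 0 \<le> s) at_top"
    using lim[unfolded filterlim_at_top_dense, rule_format, of "max 0 t"]
    by (intro eventually_conj eventually_ge_at_top)
  then obtain s where s: "max 0 t < l0 s \<omega>" "0 \<le> s"
    using eventually_happens by fastforce
  then have "\<tau> (ennreal t) \<omega> < ennreal s"
    by (subst \<tau>_less_iff[OF \<omega>]) (auto intro!: ennreal_lessI)
  then show ?thesis by auto
qed

text \<open>\<open>Z\<close> is prescribed only at nonnegative times and on the sample space,
  because the integral against \<open>\<Lambda>\<close> is identified only there.\<close>

lemma time_changed_local_martingale:
  assumes f: "f \<in> Domain A \<inter> Domain B"
    and unbounded: "AE \<omega> in M. filterlim (\<lambda>t. l0 t \<omega>) at_top at_top"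
    and g: "continuous_on UNIV g" and g_eq: "\<And>x. x \<in> \<Xi> \<Longrightarrow> g x = op_val B f x"
    and \<eta>: "\<And>n. stopping_time G (\<eta> n)" and \<eta>_lim: "AE \<omega> in M. (\<lambda>n. \<eta> n \<omega>) \<longlonglongrightarrow> \<infinity>"
    and \<eta>_int: "\<And>n. (\<integral>\<^sup>+\<omega>. \<tau> (\<eta> n \<omega>) \<omega> \<partial>M) < \<infinity>"
    and Z: "\<And>t \<omega>. 0 \<le> t \<Longrightarrow> \<omega> \<in> space M \<Longrightarrow> Z t \<omega> =
        apply_bcontfun f (X t \<omega>) - apply_bcontfun f (X 0 \<omega>)
        - (LINT s:{0..t}|lborel. apply_bcontfun (op_val A f) (X s \<omega>))
        - changed_control_integral g t \<omega>"
  shows "local_martingale M G Z"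
proof -
  let ?f = "apply_bcontfun f" and ?a = "apply_bcontfun (op_val A f)"
  have f_cont: "continuous_on UNIV ?f" and a_cont: "continuous_on UNIV ?a"
    using apply_bcontfun by (auto simp: bcontfun_def)
  have fm[measurable]: "?f \<in> borel_measurable borel" and am: "?a \<in> borel_measurable borel"
    and gm: "g \<in> borel_measurable borel"
    by (auto intro: borel_measurable_continuous_onI f_cont a_cont g)
  have f_bound: "\<bar>?f x\<bar> \<le> norm f" and a_bound: "\<bar>?a x\<bar> \<le> norm (op_val A f)" for x
    using norm_bounded[of f x] norm_bounded[of "op_val A f" x] by auto
  obtain K where K: "0 \<le> K" "\<And>x. \<bar>g x\<bar> \<le> K"
    using compact_UNIV_bounded[OF _ g] compact_Times[OF compact_E compact_U] by auto
  \<comment> \<open>Up to time t the measures dl0 and \<open>L1\<close> have masses l0 t and t - l0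
    t, both at most t, and their integrands are bounded by the two summands.\<close>
  define c where "c = norm (op_val A f) + K"
  define N where "N t \<omega> = ?f (Y t \<omega>) - ?f (Y 0 \<omega>)
      - (LINT s:{0..t}|stieltjes (\<lambda>s. l0 s \<omega>). ?a (Y s \<omega>)) - control_integral g {0..t} \<omega>" for t \<omega>
  define D where "D \<omega> = ?f (Y 0 \<omega>) - ?f (X 0 \<omega>)" for \<omega>

  have Y_set: "set_borel_measurable borel {0..t} (\<lambda>r. ?a (Y r \<omega>))" if "\<omega> \<in> space M" for \<omega> t
  proof -
    have "(\<lambda>r. indicat_real {0..t} r *\<^sub>R ?a (Y (max 0 r) \<omega>)) \<in> borel_measurable borel"
      using Y_path_measurable[OF that am] by (intro borel_measurable_scaleR) auto
    then show ?thesis unfolding set_borel_measurable_def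
      by (rule measurable_cong[THEN iffD1, rotated]) (auto simp: indicator_def)
  qed
  have N_martingale: "martingale M F N"
  proof (rule martingaleI)
    let ?N' = "\<lambda>t \<omega>. ?f (Y t \<omega>) - ?f (Y 0 \<omega>)
            - (LINT s:{0..t}|stieltjes (\<lambda>s. l0 s \<omega>). ?a (Y s \<omega>))
            - (LINT z:{0..t} \<times> UNIV|L1 \<omega>. op_val B f (Y (fst z) \<omega>, snd z))"
    \<comment> \<open>The carrier condition holds at each sample point, so replacing
      \<open>op_val B f\<close> by \<open>g\<close> changes the integral at none of them and
      adaptedness passes to \<open>N\<close> without completeness.\<close>
    have N': "N t \<omega> = ?N' t \<omega>" if "0 \<le> t" "\<omega> \<in> space M" for t \<omega>
      using control_integral_op_val_B[OF that(2) op_val_B g g_eq that(1)] f by (simp add: N_def)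
    have mart: "martingale M F ?N'" by (rule martingale_property[OF f])
    show "N t \<in> borel_measurable (F (ennreal t))" if "0 \<le> t" for t
      using mart that unfolding martingale_def
      by (subst measurable_cong[OF N'[OF that]]) (auto simp: space_F)
    show "integrable M (N t)" if "0 \<le> t" for t
      using mart that unfolding martingale_def
      by (subst Bochner_Integration.integrable_cong[OF refl N'[OF that]]) auto
    show "(LINT \<omega>:H|M. N t \<omega>) = (LINT \<omega>:H|M. N s \<omega>)"
      if "0 \<le> s" "s \<le> t" "H \<in> sets (F (ennreal s))" for s t H
    proof -
      have "(LINT \<omega>:H|M. N r \<omega>) = (LINT \<omega>:H|M. ?N' r \<omega>)" if "0 \<le> r" for r
        unfolding set_lebesgue_integral_def[where M=M]
        by (intro Bochner_Integration.integral_cong) (simp_all add: N'[OF that])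
      then show ?thesis
        using martingale_set_integral[OF mart that] that by simp
    qed
  qed
  have N_rc: "((\<lambda>s. N s \<omega>) \<longlongrightarrow> N s \<omega>) (at_right s)" if \<omega>: "\<omega> \<in> space M" and s: "0 \<le> s" for \<omega> s
  proof -
    interpret p: clock_path "path \<omega>" by (rule clock_path[OF \<omega>])
    have "((\<lambda>t. LINT r:{0..t}|stieltjes (path \<omega>). ?a (Y r \<omega>)) \<longlongrightarrow>
        (LINT r:{0..s}|stieltjes (path \<omega>). ?a (Y r \<omega>))) (at_right s)"
    proof (rule tendsto_at_right_Lipschitz[where K="norm (op_val A f)"])
      fix t assume st: "s \<le> t"
      from mult_left_mono[OF p.l_Lipschitz[OF s st] norm_ge_zero[of "op_val A f"]]
        p.stieltjes_integral_increment[OF s st Y_set[OF \<omega>] a_bound]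
      show "\<bar>(LINT r:{0..t}|stieltjes (path \<omega>). ?a (Y r \<omega>)) - (LINT r:{0..s}|stieltjes (path \<omega>). ?a (Y r \<omega>))\<bar>
          \<le> norm (op_val A f) * (t - s)" by linarith
    qed
    moreover have "((\<lambda>t. ?f (Y t \<omega>)) \<longlongrightarrow> ?f (Y s \<omega>)) (at_right s)"
      by (rule continuous_on_tendsto_compose[OF f_cont Y_right_continuous[OF \<omega> s]]) auto
    ultimately show ?thesis
      unfolding N_def by (intro tendsto_diff tendsto_const control_integral_right_continuous[OF \<omega> s gm K(2)])
  qed
  have N_bound: "\<bar>N t \<omega>\<bar> \<le> 2 * norm f + c * t" if \<omega>: "\<omega> \<in> space M" and t: "0 \<le> t" for \<omega> t
  proof -
    interpret p: clock_path "path \<omega>" by (rule clock_path[OF \<omega>])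
    have "\<bar>(LINT r:{0..t}|stieltjes (path \<omega>). ?a (Y r \<omega>)) - (LINT r:{}|stieltjes (path \<omega>). ?a (Y r \<omega>))\<bar>
        \<le> norm (op_val A f) * measure (stieltjes (path \<omega>)) ({0..t} - {})"
      by (rule set_integral_increment_bound)
        (use Y_set[OF \<omega>, of t] t a_bound in \<open>auto simp: p.sets_stieltjes p.emeasure_stieltjes_Icc
           set_borel_measurable_def cong: measurable_cong_sets\<close>)
    then have "\<bar>LINT r:{0..t}|stieltjes (path \<omega>). ?a (Y r \<omega>)\<bar> \<le> norm (op_val A f) * l0 t \<omega>"
      using p.emeasure_stieltjes_Icc[OF t] p.l_nonneg[OF t]
      by (simp add: measure_def set_lebesgue_integral_def[of _ "{}"])
    also have "\<dots> \<le> norm (op_val A f) * t"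
      using p.l_le[OF t] by (intro mult_left_mono) auto
    finally have "\<bar>LINT r:{0..t}|stieltjes (path \<omega>). ?a (Y r \<omega>)\<bar> \<le> norm (op_val A f) * t" .
    moreover have "\<bar>control_integral g {0..t} \<omega>\<bar> \<le> K * t"
    proof -
      have "K * (t - l0 t \<omega>) \<le> K * t" using K(1) p.l_nonneg[OF t] by (intro mult_left_mono) auto
      then show ?thesis using control_integral_bound[OF \<omega> t gm K(2)] by linarith
    qed
    ultimately show ?thesis
      using f_bound[of "Y t \<omega>"] f_bound[of "Y 0 \<omega>"] unfolding N_def c_def distrib_right by linarith
  qed

  have Z_adapted: "Z t \<in> borel_measurable (G (ennreal t))" if t: "0 \<le> t" for t
  proof -
    have [measurable]: "X t \<in> G (ennreal t) \<rightarrow>\<^sub>M borel" "X 0 \<in> G (ennreal t) \<rightarrow>\<^sub>M borel"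
      using t by (auto intro: X_adapted G.measurable_mono[OF X_adapted])
    have "(\<lambda>\<omega>. ?f (X t \<omega>) - ?f (X 0 \<omega>) - (LINT s:{0..t}|lborel. ?a (X s \<omega>)) - changed_control_integral g t \<omega>)
        \<in> borel_measurable (G (ennreal t))"
      by (intro borel_measurable_diff time_integral_adapted[OF am t] changed_control_integral_adapted[OF g]
          measurable_compose[OF _ fm]) auto
    then show ?thesis
      by (subst measurable_cong[OF Z[OF t]]) (auto simp: G.space_F)
  qed
  have Z_rc: "((\<lambda>s. Z s \<omega>) \<longlongrightarrow> Z s \<omega>) (at_right s)" if \<omega>: "\<omega> \<in> space M" and s: "0 \<le> s" for \<omega> s
  proof -
    have "((\<lambda>t. ?f (X t \<omega>)) \<longlongrightarrow> ?f (X s \<omega>)) (at_right s)"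
      by (rule continuous_on_tendsto_compose[OF f_cont X_right_continuous[OF \<omega> s]]) auto
    then have "((\<lambda>t. ?f (X t \<omega>) - ?f (X 0 \<omega>) - (LINT s:{0..t}|lborel. ?a (X s \<omega>)) - changed_control_integral g t \<omega>)
        \<longlongrightarrow> Z s \<omega>) (at_right s)"
      unfolding Z[OF s \<omega>]
      by (intro tendsto_diff tendsto_const time_integral_right_continuous[OF \<omega> am a_bound s]
          changed_control_integral_right_continuous[OF \<omega> s gm K(2)])
    moreover have "eventually (\<lambda>t. ?f (X t \<omega>) - ?f (X 0 \<omega>) - (LINT s:{0..t}|lborel. ?a (X s \<omega>))
        - changed_control_integral g t \<omega> = Z t \<omega>) (at_right s)"
      unfolding eventually_at_right_field using Z[OF _ \<omega>] s by (intro exI[of _ "s + 1"]) auto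
    ultimately show ?thesis by (rule Lim_transform_eventually)
  qed
  \<comment> \<open>One null set serves all t at once, so that a random time can be inserted
    below.\<close>
  have Z_N: "AE \<omega> in M. \<forall>t\<ge>0. Z t \<omega> = N (enn2real (\<tau> (ennreal t) \<omega>)) \<omega> + D \<omega>"
    using unbounded AE_space
  proof (eventually_elim, intro allI impI)
    fix \<omega> t assume lim: "filterlim (\<lambda>t. l0 t \<omega>) at_top at_top" and \<omega>: "\<omega> \<in> space M" and t: "0 \<le> (t::real)"
    interpret p: clock_path "path \<omega>" by (rule clock_path[OF \<omega>])
    have fin: "\<tau> (ennreal t) \<omega> \<noteq> \<infinity>" by (rule \<tau>_finite[OF \<omega> lim])
    then have fin': "p.icl (ennreal t) \<noteq> \<infinity>" by (simp add: \<tau>_eq_icl[OF \<omega>])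
    have "(LINT s:{0..t}|lborel. ?a (X s \<omega>)) = (LINT s:{0..t}|lborel. ?a (Y (max 0 (p.tr s)) \<omega>))"
      by (simp add: X_eq[OF \<omega>] p.tr_nonneg max_absorb2)
    also have "\<dots> = (LINT r:{0..p.tr t}|stieltjes (path \<omega>). ?a (Y (max 0 r) \<omega>))"
      by (rule p.stieltjes_change_of_variables[OF t fin' Y_path_measurable[OF \<omega> am]])
    also have "\<dots> = (LINT r:{0..p.tr t}|stieltjes (path \<omega>). ?a (Y r \<omega>))"
      unfolding set_lebesgue_integral_def
      by (intro Bochner_Integration.integral_cong) (auto simp: indicator_def)
    finally show "Z t \<omega> = N (enn2real (\<tau> (ennreal t) \<omega>)) \<omega> + D \<omega>"
      using fin unfolding Z[OF t \<omega>] N_def D_def changed_control_integral_eq enn2real_\<tau>[OF \<omega>]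
      by (simp add: X_eq[OF \<omega>])
  qed

  \<comment> \<open>\<open>\<eta>\<close> is not assumed monotone, but a localizing sequence must
    increase. At each sample point the maximum is one of the finitely many values, so
    \<open>\<tau>\<close> there is at most the sum of the integrable times.\<close>
  define \<sigma> where "\<sigma> n \<omega> = Max ((\<lambda>k. \<eta> k \<omega>) ` {..n})" for n \<omega>
  have \<sigma>_le: "\<sigma> n \<omega> \<le> t \<longleftrightarrow> (\<forall>k\<in>{..n}. \<eta> k \<omega> \<le> t)" for n \<omega> t
    unfolding \<sigma>_def by (subst Max_le_iff) auto
  have \<sigma>_stop: "stopping_time G (\<sigma> n)" for n
    unfolding stopping_time_def \<sigma>_le
    using stopping_timeD[OF \<eta>] by (intro allI pred_intros_finite) auto
  have \<sigma>_int: "(\<integral>\<^sup>+\<omega>. \<tau> (\<sigma> n \<omega>) \<omega> \<partial>M) < \<infinity>" for n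
  proof -
    have "(\<integral>\<^sup>+\<omega>. \<tau> (\<sigma> n \<omega>) \<omega> \<partial>M) \<le> (\<integral>\<^sup>+\<omega>. (\<Sum>k\<le>n. \<tau> (\<eta> k \<omega>) \<omega>) \<partial>M)"
    proof (rule nn_integral_mono)
      fix \<omega>
      have "\<sigma> n \<omega> \<in> (\<lambda>k. \<eta> k \<omega>) ` {..n}" unfolding \<sigma>_def by (rule Max_in) auto
      then obtain k where k: "k \<le> n" "\<sigma> n \<omega> = \<eta> k \<omega>" by auto
      then show "\<tau> (\<sigma> n \<omega>) \<omega> \<le> (\<Sum>k\<le>n. \<tau> (\<eta> k \<omega>) \<omega>)"
        using member_le_sum[of k "{..n}" "\<lambda>k. \<tau> (\<eta> k \<omega>) \<omega>"] by auto
    qed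
    also have "\<dots> = (\<Sum>k\<le>n. \<integral>\<^sup>+\<omega>. \<tau> (\<eta> k \<omega>) \<omega> \<partial>M)"
      by (intro nn_integral_sum stopping_time_measurable stopping_time_\<tau>_compose \<eta>)
    also have "\<dots> < \<infinity>" using \<eta>_int by (simp add: sum_Pinfty less_top[symmetric])
    finally show ?thesis .
  qed
  have D_int: "integrable M D"
  proof (rule integrable_const_bound[where B="2 * norm f"])
    show "D \<in> borel_measurable M"
      unfolding D_def[abs_def]
      by (intro borel_measurable_diff measurable_compose[OF _ fm]
          measurable_F[OF Y_adapted] G.measurable_F[OF X_adapted]) auto
    show "AE \<omega> in M. norm (D \<omega>) \<le> 2 * norm f"
    proof (rule AE_I2)
      fix \<omega> show "norm (D \<omega>) \<le> 2 * norm f"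
        using f_bound[of "Y 0 \<omega>"] f_bound[of "X 0 \<omega>"] unfolding D_def real_norm_def by linarith
    qed
  qed
  have "martingale M G (stopped Z (\<sigma> n))" for n
  proof (rule G.stopped_martingaleI[OF Z_adapted Z_rc \<sigma>_stop, where C="expectation (N 0) + expectation D"])
    fix S assume S: "stopping_time G S" and S_le: "\<And>\<omega>. \<omega> \<in> space M \<Longrightarrow> S \<omega> \<noteq> \<infinity> \<and> S \<omega> \<le> \<sigma> n \<omega>"
    have "(\<integral>\<^sup>+\<omega>. \<tau> (S \<omega>) \<omega> \<partial>M) \<le> (\<integral>\<^sup>+\<omega>. \<tau> (\<sigma> n \<omega>) \<omega> \<partial>M)"
      using S_le by (intro nn_integral_mono \<tau>_mono) auto
    also have "\<dots> < \<infinity>" by (rule \<sigma>_int)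
    finally have fin: "(\<integral>\<^sup>+\<omega>. \<tau> (S \<omega>) \<omega> \<partial>M) < \<infinity>" .
    have c0: "0 \<le> c" using K(1) by (simp add: c_def)
    note stop = optional_stopping[OF N_martingale N_rc stopping_time_\<tau>_compose[OF S] fin _ c0 N_bound]
    have int: "integrable M (\<lambda>\<omega>. N (enn2real (\<tau> (S \<omega>) \<omega>)) \<omega> + D \<omega>)"
      using stop(1) D_int by auto
    have eq: "AE \<omega> in M. Z (enn2real (S \<omega>)) \<omega> = N (enn2real (\<tau> (S \<omega>) \<omega>)) \<omega> + D \<omega>"
      using Z_N AE_space
    proof eventually_elim
      fix \<omega> assume *: "\<forall>t\<ge>0. Z t \<omega> = N (enn2real (\<tau> (ennreal t) \<omega>)) \<omega> + D \<omega>" and "\<omega> \<in> space M"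
      then have "ennreal (enn2real (S \<omega>)) = S \<omega>" using S_le by (simp add: ennreal_enn2real_if)
      with *[rule_format, OF enn2real_nonneg, of "S \<omega>"]
      show "Z (enn2real (S \<omega>)) \<omega> = N (enn2real (\<tau> (S \<omega>) \<omega>)) \<omega> + D \<omega>" by simp
    qed
    \<comment> \<open>\<open>M\<close> need not be complete, so almost sure equality with a
      measurable function does not suffice for measurability; right continuity of \<open>Z\<close>
      does.\<close>
    have ZS: "(\<lambda>\<omega>. Z (enn2real (S \<omega>)) \<omega>) \<in> borel_measurable M"
    proof (rule measurable_compose_right_continuous_unbounded[where W=Z and R="\<lambda>\<omega>. enn2real (S \<omega>)"])
      show "(\<lambda>\<omega>. enn2real (S \<omega>)) \<in> borel_measurable M"
        using G.stopping_time_measurable[OF S] by measurable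
    qed (auto intro: Z_rc G.measurable_F[OF Z_adapted])
    show "integrable M (\<lambda>\<omega>. Z (enn2real (S \<omega>)) \<omega>) \<and>
        expectation (\<lambda>\<omega>. Z (enn2real (S \<omega>)) \<omega>) = expectation (N 0) + expectation D"
    proof
      show "integrable M (\<lambda>\<omega>. Z (enn2real (S \<omega>)) \<omega>)"
        using int eq ZS by (subst integrable_cong_AE) auto
      have "expectation (\<lambda>\<omega>. Z (enn2real (S \<omega>)) \<omega>) = expectation (\<lambda>\<omega>. N (enn2real (\<tau> (S \<omega>) \<omega>)) \<omega> + D \<omega>)"
        using int eq ZS by (intro integral_cong_AE) auto
      then show "expectation (\<lambda>\<omega>. Z (enn2real (S \<omega>)) \<omega>) = expectation (N 0) + expectation D"
        using stop D_int by simp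
    qed
  qed
  moreover have "AE \<omega> in M. incseq (\<lambda>n. \<sigma> n \<omega>) \<and> (\<lambda>n. \<sigma> n \<omega>) \<longlonglongrightarrow> \<infinity>"
    using \<eta>_lim
  proof eventually_elim
    fix \<omega> assume lim: "(\<lambda>n. \<eta> n \<omega>) \<longlonglongrightarrow> \<infinity>"
    have "incseq (\<lambda>n. \<sigma> n \<omega>)" unfolding \<sigma>_def by (intro monoI Max_mono) auto
    moreover have "(\<lambda>n. \<sigma> n \<omega>) \<longlonglongrightarrow> \<infinity>"
      by (rule tendsto_sandwich[OF _ _ lim tendsto_const]) (auto simp: \<sigma>_def intro!: always_eventually)
    ultimately show "incseq (\<lambda>n. \<sigma> n \<omega>) \<and> (\<lambda>n. \<sigma> n \<omega>) \<longlonglongrightarrow> \<infinity>" ..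
  qed
  ultimately show ?thesis
    unfolding local_martingale_def using Z_adapted \<sigma>_stop by blast
qed

end

theorem theorem3p6:
  fixes A :: "(('e::metric_space \<Rightarrow>\<^sub>C real) \<times> ('e \<Rightarrow>\<^sub>C real)) set"
    and E0 :: "'e set"
    and B :: "(('e \<Rightarrow>\<^sub>C real) \<times> ('e \<times> 'u::metric_space \<Rightarrow> real)) set"
    and \<Xi> :: "('e \<times> 'u) set"
    and M :: "'w measure" and F G :: "ennreal \<Rightarrow> 'w measure"
    and Y X :: "real \<Rightarrow> 'w \<Rightarrow> 'e"
    and l0 :: "real \<Rightarrow> 'w \<Rightarrow> real"
    and L1 :: "'w \<Rightarrow> (real \<times> 'u) measure"
    and \<tau> :: "ennreal \<Rightarrow> 'w \<Rightarrow> ennreal"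
    and \<Lambda> :: "'w \<Rightarrow> (real \<times> ('e \<times> 'u)) measure"
    and \<eta> :: "nat \<Rightarrow> 'w \<Rightarrow> ennreal"
  assumes "compact (UNIV :: 'e set)" and "compact (UNIV :: 'u set)"
    and "open E0"
    and "single_valued A" and "(const_bcontfun 1, const_bcontfun 0) \<in> A"
    and "closed \<Xi>" and "\<Xi> \<subseteq> (- E0) \<times> UNIV"
    and "single_valued B" and "Range B \<subseteq> cont_funs \<Xi>" and "(const_bcontfun 1, \<lambda>z\<in>\<Xi>. 0) \<in> B"
    and dense: "closure (Domain A \<inter> Domain B) = UNIV"
    and existence: "\<And>\<nu>. \<nu> \<in> prob_measures_on (closure E0) \<Longrightarrow> solution_laws A E0 B \<Xi> \<nu> \<noteq> {}"
    and clock_unbounded: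
      "\<And>(M' :: 'w measure) F' Y' l0' L1'.
         controlled_martingale_solution M' F' A E0 B \<Xi> Y' l0' L1' \<Longrightarrow>
         AE \<omega> in M'. filterlim (\<lambda>t. l0' t \<omega>) at_top at_top"
    and solution: "controlled_martingale_solution M F A E0 B \<Xi> Y l0 L1"
    and "right_continuous_filtration F"
    and \<tau>_def: "\<tau> = inverse_clock l0"
    and G_def: "G = (\<lambda>t. filtration.pre_sigma (space M) F (\<tau> t))"
    and X_def: "X = time_changed Y l0"
    and \<Lambda>_sets: "\<And>\<omega>. \<omega> \<in> space M \<Longrightarrow> sets (\<Lambda> \<omega>) = sets (restrict_space borel ({0..} \<times> \<Xi>))"
    and \<Lambda>_def: "\<And>\<omega> t C. \<omega> \<in> space M \<Longrightarrow> 0 \<le> t \<Longrightarrow> C \<in> sets borel \<Longrightarrow> C \<subseteq> \<Xi> \<Longrightarrow>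
          emeasure (\<Lambda> \<omega>) ({0..t} \<times> C) =
            (\<integral>\<^sup>+z\<in>{s. 0 \<le> s \<and> ennreal s \<le> \<tau> (ennreal t) \<omega>} \<times> UNIV.
               indicator C (Y (fst z) \<omega>, snd z) \<partial>L1 \<omega>)"
    and "\<And>n. stopping_time G (\<eta> n)"
    and "AE \<omega> in M. (\<lambda>n. \<eta> n \<omega>) \<longlonglongrightarrow> \<infinity>"
    and "\<And>n. (\<integral>\<^sup>+\<omega>. \<tau> (\<eta> n \<omega>) \<omega> \<partial>M) < \<infinity>"
  shows "(AE \<omega> in M. (\<lambda>t. X t \<omega>) \<in> skorohod_paths (closure E0)) \<and>
    (\<forall>f \<in> Domain A \<inter> Domain B.
       local_martingale M G (\<lambda>t \<omega>.
         apply_bcontfun f (X t \<omega>) - apply_bcontfun f (X 0 \<omega>)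
         - (LINT s:{0..t}|lborel. apply_bcontfun (op_val A f) (X s \<omega>))
         - (LINT z:{0..t} \<times> \<Xi>|\<Lambda> \<omega>. op_val B f (snd z))))"
proof -
  \<comment> \<open>The interpretation that follows brings its own \<open>G_def\<close>, which hides
    the hypothesis of that name.\<close>
  note G_pre_sigma = G_def
  have "compact_controlled_solution M F A E0 B \<Xi> Y l0 L1"
    using solution assms by (auto intro!: compact_controlled_solution.intro compact_controlled_solution_axioms.intro)
  then interpret compact_controlled_solution M F A E0 B \<Xi> Y l0 L1 .
  have G_eq: "G = compact_controlled_solution.G M F l0"
    by (simp add: G_pre_sigma \<tau>_def G_def fun_eq_iff)
  have unbounded: "AE \<omega> in M. filterlim (\<lambda>t. l0 t \<omega>) at_top at_top"
    by (rule clock_unbounded[OF solution])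
  show ?thesis
  proof (intro conjI ballI)
    show "AE \<omega> in M. (\<lambda>t. X t \<omega>) \<in> skorohod_paths (closure E0)"
      using unbounded AE_space unfolding X_def
      by eventually_elim (intro time_changed_in_skorohod_paths \<tau>_finite)
    fix f assume f: "f \<in> Domain A \<inter> Domain B"
    have h: "op_val B f \<in> cont_funs \<Xi>" using f by (intro op_val_B) auto
    then obtain g where g: "continuous_on UNIV g" "\<And>x. x \<in> \<Xi> \<Longrightarrow> g x = op_val B f x"
      using continuous_extension_from_closed[OF closed_\<Xi>] by (auto simp: cont_funs_def)
    show "local_martingale M G (\<lambda>t \<omega>.
         apply_bcontfun f (X t \<omega>) - apply_bcontfun f (X 0 \<omega>)
         - (LINT s:{0..t}|lborel. apply_bcontfun (op_val A f) (X s \<omega>))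
         - (LINT z:{0..t} \<times> \<Xi>|\<Lambda> \<omega>. op_val B f (snd z)))"
      unfolding G_eq
    proof (rule time_changed_local_martingale[OF f unbounded g])
      fix t \<omega> assume t: "0 \<le> (t::real)" and \<omega>: "\<omega> \<in> space M"
      have "(LINT z:{0..t} \<times> \<Xi>|\<Lambda> \<omega>. op_val B f (snd z)) = changed_control_integral g t \<omega>"
        using \<Lambda>_def[OF \<omega> t] g
        by (intro integral_image_measure[OF \<omega> t \<Lambda>_sets[OF \<omega>]])
          (auto simp: \<tau>_def intro: borel_measurable_continuous_onI)
      then show "apply_bcontfun f (X t \<omega>) - apply_bcontfun f (X 0 \<omega>)
         - (LINT s:{0..t}|lborel. apply_bcontfun (op_val A f) (X s \<omega>))
         - (LINT z:{0..t} \<times> \<Xi>|\<Lambda> \<omega>. op_val B f (snd z)) =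
         apply_bcontfun f (time_changed Y l0 t \<omega>) - apply_bcontfun f (time_changed Y l0 0 \<omega>)
         - (LINT s:{0..t}|lborel. apply_bcontfun (op_val A f) (time_changed Y l0 s \<omega>))
         - changed_control_integral g t \<omega>"
        by (simp add: X_def)
    qed (use assms G_eq in auto)
  qed
qed

end
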